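(* Let $\alpha\in\mathbb{R}$, $1<p,q<\infty$, $0<\lambda<\min\{\alpha+n/p,\alpha+m/p\}$, and $$\max\left\{-\frac np,-\frac mp\right\}<\alpha<\min\left\{n\left(1-\frac1p\right),m\left(1-\frac1p\right)\right\}.$$ Then for every $f\in\operatorname{bmo}(\mathbb{R}^n\times\mathbb{R}^m)\setminus\mathcal{C}$ there exist constants $C_1,C_2>0$ such that, for any $\gamma>0$ and $R\in\mathcal{R}$, $$\left\|\chi_{\{z\in R:|f(z)-f_R|>\gamma\}}\right\|_{M\vec{\dot K}_{p,q}^{\alpha,\lambda}(\mathbb{R}^n\times\mathbb{R}^m)}\le C_1e^{-\frac{C_2\gamma}{\|f\|_{\mathrm{bmo}}}}\|\chi_R\|_{M\vec{\dot K}_{p,q}^{\alpha,\lambda}(\mathbb{R}^n\times\mathbb{R}^m)}.$$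
   Context: $n,m$ are positive integers. For $x\in\mathbb{R}^d$, $r>0$, $Q(x,r)$ is the cube centered at $x$ with side length $r$; $\mathcal{R}$ is the set of all $Q(x,r)\times Q(y,s)$, $x\in\mathbb{R}^n$, $y\in\mathbb{R}^m$, $r,s>0$. $\chi_E$ is the characteristic function of $E$. A locally integrable $f$ belongs to little bmo, $\operatorname{bmo}(\mathbb{R}^n\times\mathbb{R}^m)$, if $$\|f\|_{\mathrm{bmo}}=\sup_{R\in\mathcal{R}}\frac{\|(f-f_R)\chi_R\|_{L^1}}{\|\chi_R\|_{L^1}}<\infty,\qquad f_R=\frac1{|R|}\int_Rf(z)\,dz.$$ $\mathcal{C}$ is the set of constant functions (functions being identified when equal almost everywhere). For $k\in\mathbb{Z}$, $Q_k=Q(0,2^k)$ (in $\mathbb{R}^n$ or $\mathbb{R}^m$); $R_{i,j}=Q_i\times Q_j$; $I_i=Q_i\setminus Q_{i-1}\subset\mathbb{R}^n$, $J_j=Q_j\setminus Q_{j-1}\subset\mathbb{R}^m$; $\chi_{i,j}$ is the characteristic function of $I_i\times J_j$. For measurable $f$, $$\|f\|_{\vec{\dot K}_{p,q}^{\alpha}}=\Big(\sum_{i,j\in\mathbb{Z}}2^{(i+j)q\alpha}\|f\chi_{i,j}\|_{L^p(\mathbb{R}^n\times\mathbb{R}^m)}^q\Big)^{1/q},\qquad \|f\|_{M\vec{\dot K}_{p,q}^{\alpha,\lambda}}=\sup_{L_1,L_2\in\mathbb{Z}}2^{-(L_1+L_2)\lambda}\|f\chi_{R_{L_1,L_2}}\|_{\vec{\dot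 K}_{p,q}^{\alpha}}.$$ *)

theory Defs
  imports "HOL-Analysis.Analysis"
begin

text \<open>
  Closed cubes are used throughout. Replacing them by open cubes changes every set below by a
  null set only, so all norms are unaffected.
\<close>

definition cube :: "real^'d \<Rightarrow> real \<Rightarrow> (real^'d) set" where
  "cube x r = cbox (\<chi> i. x $ i - r / 2) (\<chi> i. x $ i + r / 2)"

definition rectangles :: "((real^'n) \<times> (real^'m)) set set" where
  "rectangles = {cube x r \<times> cube y s | x y r s. 0 < r \<and> 0 < s}"

text \<open>Extends the real power function (for exponents \<open>a > 0\<close>) to \<open>[0, \<infinity>]\<close>.\<close>

definition epowr :: "ennreal \<Rightarrow> real \<Rightarrow> ennreal" where
  "epowr x a = (if x = \<infinity> then \<infinity> else ennreal (enn2real x powr a))"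

definition lp_norm :: "real \<Rightarrow> ('x::euclidean_space \<Rightarrow> 'b::real_normed_vector) \<Rightarrow> ennreal" where
  "lp_norm p f = epowr (\<integral>\<^sup>+ z. ennreal (norm (f z) powr p) \<partial>lebesgue) (1 / p)"

definition restr :: "('x \<Rightarrow> 'b::real_normed_vector) \<Rightarrow> 'x set \<Rightarrow> 'x \<Rightarrow> 'b" where
  "restr f E = (\<lambda>z. indicat_real E z *\<^sub>R f z)"

definition locally_integrable ::
    "('x::euclidean_space \<Rightarrow> 'b::{banach, second_countable_topology}) \<Rightarrow> bool" where
  "locally_integrable f \<longleftrightarrow> (\<forall>K. compact K \<longrightarrow> set_integrable lebesgue K f)"

definition average ::
    "('x::euclidean_space \<Rightarrow> 'b::{banach, second_countable_topology}) \<Rightarrow> 'x set \<Rightarrow> 'b" where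
  "average f R = (1 / measure lebesgue R) *\<^sub>R (LINT z:R|lebesgue. f z)"

definition bmo_norm ::
    "((real^'n) \<times> (real^'m) \<Rightarrow> 'b::{banach, second_countable_topology}) \<Rightarrow> ennreal" where
  "bmo_norm f = (SUP R\<in>rectangles.
     lp_norm 1 (restr (\<lambda>z. f z - average f R) R) / lp_norm 1 (indicat_real R))"

definition bmo :: "((real^'n) \<times> (real^'m) \<Rightarrow> 'b::{banach, second_countable_topology}) set" where
  "bmo = {f. locally_integrable f \<and> bmo_norm f < \<infinity>}"

definition ae_constant :: "('x::euclidean_space \<Rightarrow> 'b) set" where
  "ae_constant = {f. \<exists>c. AE z in lebesgue. f z = c}"

definition dyadic_cube :: "int \<Rightarrow> (real^'d) set" where
  "dyadic_cube k = cube 0 (2 powr real_of_int k)"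

definition dyadic_shell :: "int \<Rightarrow> (real^'d) set" where
  "dyadic_shell k = dyadic_cube k - dyadic_cube (k - 1)"

definition herz_norm ::
    "real \<Rightarrow> real \<Rightarrow> real \<Rightarrow> ((real^'n) \<times> (real^'m) \<Rightarrow> 'b::real_normed_vector) \<Rightarrow> ennreal" where
  "herz_norm \<alpha> p q f =
     epowr (\<Sum>\<^sub>\<infinity>(i, j)\<in>UNIV. ennreal (2 powr (real_of_int (i + j) * q * \<alpha>)) *
              epowr (lp_norm p (restr f (dyadic_shell i \<times> dyadic_shell j))) q)
           (1 / q)"

definition morrey_herz_norm ::
    "real \<Rightarrow> real \<Rightarrow> real \<Rightarrow> real \<Rightarrow> ((real^'n) \<times> (real^'m) \<Rightarrow> 'b::real_normed_vector) \<Rightarrow> ennreal" where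
  "morrey_herz_norm \<alpha> lam p q f =
     (SUP (L\<^sub>1, L\<^sub>2)\<in>UNIV. ennreal (2 powr (- (real_of_int (L\<^sub>1 + L\<^sub>2) * lam))) *
        herz_norm \<alpha> p q (restr f (dyadic_cube L\<^sub>1 \<times> dyadic_cube L\<^sub>2)))"

end

theory Submission
  imports Defs
begin

text \<open>
  Bisecting all sides of a rectangle again produces products of cubes, so the John--Nirenberg
  argument works for little bmo and gives \<open>|E| \<le> \<epsilon> |R|\<close> with \<open>\<epsilon>\<close> exponentially small in \<open>\<gamma>\<close>, where
  \<open>E = {z \<in> R. |f z - f\<^sub>R| > \<gamma>}\<close>. It is run on the averages over the \<open>k\<close>-th dyadic generation, by
  induction on \<open>k\<close>; density of the continuous functions in \<open>L\<^sup>1\<close> then replaces Lebesgue's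
  differentiation theorem.

  For \<open>R = A \<times> B\<close> and the least dyadic cubes \<open>Q\<^sub>k \<supseteq> A\<close>, \<open>Q\<^sub>l \<supseteq> B\<close>, the Morrey--Herz norm of \<open>\<chi>\<^sub>R\<close> is at
  least a constant times \<open>2 powr ((k + l) * (\<alpha> - \<lambda>)) * |R| powr (1 / p)\<close>, as \<open>A\<close> and \<open>B\<close> each have a fixed
  proportion of their measure in one of four shells. Conversely
  \<open>|E \<inter> (I\<^sub>i \<times> J\<^sub>j)| \<le> (\<epsilon> |R|) powr \<theta> * (|A \<inter> I\<^sub>i| |B \<inter> J\<^sub>j|) powr (1 - \<theta>)\<close>, and for small \<open>\<theta>\<close> the
  hypothesis on \<open>\<lambda>\<close> makes the sum over \<open>i, j\<close> geometric, with a bound of the same order times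
  \<open>\<epsilon> powr (\<theta> / p)\<close>.
\<close>

section \<open>The John--Nirenberg inequality on dyadic trees\<close>

lemma set_integrable_const_lmeasurable:
  fixes c :: "'b::euclidean_space"
  assumes "S \<in> lmeasurable"
  shows "set_integrable lebesgue S (\<lambda>_. c)"
  using assms unfolding set_integrable_def
  by (intro integrable_scaleR_left integrable_real_indicator) (auto simp: fmeasurable_def)

lemma set_integral_const_lmeasurable:
  fixes c :: "'b::euclidean_space"
  assumes "S \<in> lmeasurable"
  shows "(LINT z:S|lebesgue. c) = measure lebesgue S *\<^sub>R c"
  using assms by (intro set_integral_const) (auto simp: fmeasurable_def top.not_eq_extremum)

lemma set_integrable_norm_diff:
  fixes f g :: "'a::euclidean_space \<Rightarrow> 'b::euclidean_space"
  assumes "set_integrable lebesgue S f" "set_integrable lebesgue S g"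
  shows "set_integrable lebesgue S (\<lambda>z. norm (f z - g z))"
  using set_integrable_norm[OF set_integral_diff(1)[OF assms]] .

lemma average_minus_const:
  fixes f :: "'a::euclidean_space \<Rightarrow> 'b::euclidean_space"
  assumes "S \<in> lmeasurable" "0 < measure lebesgue S" "set_integrable lebesgue S f"
  shows "average f S - c = (1 / measure lebesgue S) *\<^sub>R (LINT z:S|lebesgue. f z - c)"
proof -
  have "(LINT z:S|lebesgue. f z - c) = (LINT z:S|lebesgue. f z) - measure lebesgue S *\<^sub>R c"
    using assms by (simp add: set_integral_diff set_integrable_const_lmeasurable set_integral_const_lmeasurable)
  then show ?thesis using assms(2) by (simp add: average_def scaleR_diff_right)
qed

text \<open>The triangle inequality for the integral of \<open>f - c\<close>. It serves twice below:
  it bounds the jump of the average from a box to a child, and where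
  \<open>norm (average f S - c)\<close> is large it acts as Chebyshev's inequality for the measure
  of \<open>S\<close>.\<close>

lemma norm_average_minus_const_le:
  fixes f :: "'a::euclidean_space \<Rightarrow> 'b::euclidean_space"
  assumes S: "S \<in> lmeasurable" "0 < measure lebesgue S" and f: "set_integrable lebesgue S f"
  shows "measure lebesgue S * norm (average f S - c) \<le> (LINT z:S|lebesgue. norm (f z - c))"
proof -
  have "measure lebesgue S * norm (average f S - c) = norm (LINT z:S|lebesgue. f z - c)"
    using S by (simp add: average_minus_const[OF S f])
  also have "\<dots> \<le> (LINT z:S|lebesgue. norm (f z - c))"
    by (rule set_integral_norm_bound)
       (intro set_integral_diff(1) f set_integrable_const_lmeasurable S)
  finally show ?thesis .
qed

text \<open>Lets the average be replaced by any convenient constant \<open>c\<close> at the cost of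
  a factor 2: the error \<open>norm (average f S - c)\<close>, integrated over \<open>S\<close>, is
  again at most the deviation from \<open>c\<close>.\<close>

lemma osc_le_twice_deviation:
  fixes f :: "'a::euclidean_space \<Rightarrow> 'b::euclidean_space"
  assumes S: "S \<in> lmeasurable" "0 < measure lebesgue S" and f: "set_integrable lebesgue S f"
  shows "(LINT z:S|lebesgue. norm (f z - average f S)) \<le> 2 * (LINT z:S|lebesgue. norm (f z - c))"
proof -
  note c = set_integrable_const_lmeasurable[OF S(1)]
  note d = set_integrable_norm_diff[OF f c]
  have "(LINT z:S|lebesgue. norm (f z - average f S))
      \<le> (LINT z:S|lebesgue. norm (f z - c) + norm (average f S - c))"
    by (intro set_integral_mono set_integral_add(1) d c)
       (metis dist_norm dist_triangle2)
  also have "\<dots> = (LINT z:S|lebesgue. norm (f z - c)) + measure lebesgue S * norm (average f S - c)"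
    by (subst set_integral_add(2)[OF d c]) (simp add: set_integral_const_lmeasurable[OF S(1)])
  also have "\<dots> \<le> 2 * (LINT z:S|lebesgue. norm (f z - c))"
    using norm_average_minus_const_le[OF S f, of c] by simp
  finally show ?thesis .
qed

text \<open>Measurability is known only for \<open>f\<close> cut off to \<open>S\<close>, so the set
  is first rewritten in terms of the cut-off function.\<close>

lemma superlevel_set_lmeasurable:
  fixes f :: "'a::euclidean_space \<Rightarrow> 'b::euclidean_space"
  assumes S: "S \<in> lmeasurable" and f: "set_integrable lebesgue S f"
  shows "{z \<in> S. \<gamma> < norm (f z - a)} \<in> lmeasurable"
proof -
  have [measurable]: "(\<lambda>z. indicat_real S z *\<^sub>R f z) \<in> borel_measurable lebesgue" "S \<in> sets lebesgue"
    using f S by (auto simp: set_integrable_def fmeasurable_def)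
  have "{z \<in> S. \<gamma> < norm (f z - a)}
      = {z \<in> space lebesgue. z \<in> S \<and> \<gamma> < norm (indicat_real S z *\<^sub>R f z - a)}"
    by (auto simp: indicator_def)
  also have "\<dots> \<in> sets lebesgue" by measurable
  finally show ?thesis using S by (intro fmeasurableI2[OF S]) auto
qed

text \<open>Separates the recentring argument from the geometry of rectangles. The splitting holds
  only almost everywhere because closed children share faces. The constant \<open>D\<close> controls
  how far an average can move in one generation.\<close>

locale dyadic_tree =
  fixes I :: "'i set" and bx :: "'i \<Rightarrow> 'a::euclidean_space set"
    and C :: "'c set" and child :: "'i \<Rightarrow> 'c \<Rightarrow> 'i" and D :: real
  assumes child_in: "i \<in> I \<Longrightarrow> c \<in> C \<Longrightarrow> child i c \<in> I"
    and child_subset: "i \<in> I \<Longrightarrow> c \<in> C \<Longrightarrow> bx (child i c) \<subseteq> bx i"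
    and box_lmeasurable: "i \<in> I \<Longrightarrow> bx i \<in> lmeasurable"
    and box_pos: "i \<in> I \<Longrightarrow> 0 < measure lebesgue (bx i)"
    and box_split: "i \<in> I \<Longrightarrow>
      AE z in lebesgue. indicat_real (bx i) z = (\<Sum>c\<in>C. indicat_real (bx (child i c)) z)"
    and box_child: "i \<in> I \<Longrightarrow> c \<in> C \<Longrightarrow>
      measure lebesgue (bx i) \<le> D * measure lebesgue (bx (child i c))"
begin

text \<open>Splitting off the first generation, not the last, lets an induction on \<open>k\<close>
  restart at each child of the root with a new reference constant.\<close>

primrec gen_sum :: "('i \<Rightarrow> real) \<Rightarrow> nat \<Rightarrow> 'i \<Rightarrow> real" where
  "gen_sum u 0 i = u i"
| "gen_sum u (Suc k) i = (\<Sum>c\<in>C. gen_sum u k (child i c))"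

lemma gen_sum_mono:
  assumes "\<And>j. j \<in> I \<Longrightarrow> u j \<le> v j" "i \<in> I"
  shows "gen_sum u k i \<le> gen_sum v k i"
  using assms(2) by (induction k arbitrary: i) (auto intro!: sum_mono assms child_in)

lemma gen_sum_add: "gen_sum (\<lambda>j. u j + v j) k i = gen_sum u k i + gen_sum v k i"
  by (induction k arbitrary: i) (auto simp: sum.distrib)

lemma gen_sum_cmult: "gen_sum (\<lambda>j. a * u j) k i = a * gen_sum u k i"
  by (induction k arbitrary: i) (auto simp: sum_distrib_left)

lemma set_integral_children:
  fixes u :: "'a \<Rightarrow> real"
  assumes i: "i \<in> I" and u: "set_integrable lebesgue (bx i) u"
  shows "(LINT z:bx i|lebesgue. u z) = (\<Sum>c\<in>C. LINT z:bx (child i c)|lebesgue. u z)"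
proof -
  have uc: "set_integrable lebesgue (bx (child i c)) u" if "c \<in> C" for c
    using set_integrable_subset[OF u _ child_subset[OF i that]] box_lmeasurable[OF child_in[OF i that]]
    by (auto simp: fmeasurable_def)
  have "(LINT z:bx i|lebesgue. u z)
      = (LINT z|lebesgue. (\<Sum>c\<in>C. indicat_real (bx (child i c)) z *\<^sub>R u z))"
    unfolding set_lebesgue_integral_def
  proof (rule integral_cong_AE)
    show "AE z in lebesgue. indicat_real (bx i) z *\<^sub>R u z
        = (\<Sum>c\<in>C. indicat_real (bx (child i c)) z *\<^sub>R u z)"
      using box_split[OF i] by eventually_elim (simp add: sum_distrib_right)
  qed (use u uc in \<open>auto simp: set_integrable_def intro!: borel_measurable_sum borel_measurable_integrable\<close>)
  also have "\<dots> = (\<Sum>c\<in>C. LINT z:bx (child i c)|lebesgue. u z)"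
    unfolding set_lebesgue_integral_def using uc
    by (subst Bochner_Integration.integral_sum) (auto simp: set_integrable_def)
  finally show ?thesis .
qed

lemma measure_children:
  assumes i: "i \<in> I"
  shows "measure lebesgue (bx i) = (\<Sum>c\<in>C. measure lebesgue (bx (child i c)))"
  using set_integral_children[OF i set_integrable_const_lmeasurable[OF box_lmeasurable[OF i]], of 1]
  by (simp add: set_integral_const_lmeasurable box_lmeasurable child_in i)

lemma gen_sum_set_integral:
  fixes u :: "'a \<Rightarrow> real"
  assumes "i \<in> I" "\<And>j. j \<in> I \<Longrightarrow> set_integrable lebesgue (bx j) u"
  shows "gen_sum (\<lambda>j. LINT z:bx j|lebesgue. u z) k i = (LINT z:bx i|lebesgue. u z)"
  using assms(1)
proof (induction k arbitrary: i)
  case (Suc k i)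
  have "gen_sum (\<lambda>j. LINT z:bx j|lebesgue. u z) (Suc k) i = (\<Sum>c\<in>C. LINT z:bx (child i c)|lebesgue. u z)"
    using Suc by (simp add: child_in)
  then show ?case by (simp only: set_integral_children[OF Suc.prems assms(2)[OF Suc.prems]])
qed simp

text \<open>
  The John--Nirenberg bound for the averages over the \<open>k\<close>-th generation. In the induction step, the
  children whose average stays within \<open>2 * M\<close> of \<open>a\<close> are covered by the induction hypothesis; for the
  others, re-centre at their own average, which costs a factor \<open>3/2\<close>, and Chebyshev's inequality
  bounds their measure by the second summand.
\<close>

lemma gen_sum_exp_bound:
  fixes f :: "'a \<Rightarrow> 'b::euclidean_space"
  assumes f: "\<And>j. j \<in> I \<Longrightarrow> set_integrable lebesgue (bx j) f"
    and M: "0 < M"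
    and osc: "\<And>j. j \<in> I \<Longrightarrow>
      (LINT z:bx j|lebesgue. norm (f z - average f (bx j))) \<le> M * measure lebesgue (bx j)"
    and \<beta>: "0 \<le> \<beta>" "exp (\<beta> * ((2 + D) * M)) \<le> 3 / 2" and D: "0 \<le> D"
    and i: "i \<in> I" and a: "norm (average f (bx i) - a) \<le> 2 * M"
  shows "gen_sum (\<lambda>j. measure lebesgue (bx j) * exp (\<beta> * norm (average f (bx j) - a))) k i
    \<le> 3 / 2 * measure lebesgue (bx i) + 9 / (2 * M) * (LINT z:bx i|lebesgue. norm (f z - a))"
  using i a
proof (induction k arbitrary: i a)
  case (0 i a)
  have "\<beta> * norm (average f (bx i) - a) \<le> \<beta> * ((2 + D) * M)"
    using \<beta> D M 0 by (intro mult_left_mono) (auto simp: algebra_simps intro: order_trans)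
  then have "exp (\<beta> * norm (average f (bx i) - a)) \<le> 3 / 2"
    using \<beta> by (meson exp_le_cancel_iff order_trans)
  then have "measure lebesgue (bx i) * exp (\<beta> * norm (average f (bx i) - a)) \<le> 3 / 2 * measure lebesgue (bx i)"
    using box_pos[OF 0(1)] by simp
  moreover have "0 \<le> 9 / (2 * M) * (LINT z:bx i|lebesgue. norm (f z - a))"
    using M by (intro mult_nonneg_nonneg) (auto simp: set_lebesgue_integral_def intro!: Bochner_Integration.integral_nonneg)
  ultimately show ?case by simp
next
  case (Suc k i a)
  let ?m = "\<lambda>j. measure lebesgue (bx j)"
  let ?w = "\<lambda>a j. ?m j * exp (\<beta> * norm (average f (bx j) - a))"
  let ?d = "\<lambda>a j. LINT z:bx j|lebesgue. norm (f z - a)"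
  have d_int: "set_integrable lebesgue (bx j) (\<lambda>z. norm (f z - a))" if "j \<in> I" for j a
    by (intro set_integrable_norm_diff f that set_integrable_const_lmeasurable box_lmeasurable)
  have d_nonneg: "0 \<le> ?d a j" for a j
    by (auto simp: set_lebesgue_integral_def intro!: Bochner_Integration.integral_nonneg)
  have step: "gen_sum (?w a) k (child i c) \<le> 3 / 2 * ?m (child i c) + 9 / (2 * M) * ?d a (child i c)"
    if c: "c \<in> C" for c
  proof (cases "norm (average f (bx (child i c)) - a) \<le> 2 * M")
    case True
    then show ?thesis using Suc.IH child_in Suc.prems c by blast
  next
    case False
    define j where "j = child i c"
    have j: "j \<in> I" unfolding j_def using child_in Suc.prems c by blast
    define b where "b = average f (bx j)"
    \<comment> \<open>One generation moves the average by at most \<open>D * M\<close>: the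
      deviation over the child is dominated by the oscillation over the parent, whose measure is at
      most \<open>D\<close> times that of the child.\<close>
    have "?m j * norm (b - average f (bx i)) \<le> ?d (average f (bx i)) j"
      unfolding b_def by (intro norm_average_minus_const_le box_lmeasurable box_pos f j)
    also have "\<dots> \<le> ?d (average f (bx i)) i"
      unfolding set_lebesgue_integral_def j_def
    proof (rule integral_mono)
      fix z show "indicat_real (bx (child i c)) z *\<^sub>R norm (f z - average f (bx i))
          \<le> indicat_real (bx i) z *\<^sub>R norm (f z - average f (bx i))"
        using child_subset[OF Suc.prems(1) c] by (auto simp: indicator_def)
    qed (use d_int[OF j[unfolded j_def]] d_int[OF Suc.prems(1)] in \<open>auto simp: set_integrable_def\<close>)
    also have "\<dots> \<le> M * ?m i" by (rule osc[OF Suc.prems(1)])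
    also have "\<dots> \<le> M * (D * ?m j)"
      using M box_child[OF Suc.prems(1) c] by (simp add: j_def)
    finally have "norm (b - average f (bx i)) \<le> D * M"
      using box_pos[OF j] by (simp add: mult.left_commute mult.commute)
    then have ba: "norm (b - a) \<le> (2 + D) * M"
      using Suc.prems(2) norm_triangle_ineq[of "b - average f (bx i)" "average f (bx i) - a"]
      by (simp add: algebra_simps)
    have "gen_sum (?w a) k j \<le> gen_sum (\<lambda>l. 3 / 2 * ?w b l) k j"
    proof (rule gen_sum_mono[OF _ j])
      fix l
      have "norm (average f (bx l) - a) \<le> norm (average f (bx l) - b) + (2 + D) * M"
        using ba norm_triangle_ineq[of "average f (bx l) - b" "b - a"] by simp
      then have "\<beta> * norm (average f (bx l) - a) \<le> \<beta> * norm (average f (bx l) - b) + \<beta> * ((2 + D) * M)"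
        using \<beta>(1) by (metis distrib_left mult_left_mono)
      then have "exp (\<beta> * norm (average f (bx l) - a))
          \<le> exp (\<beta> * norm (average f (bx l) - b)) * exp (\<beta> * ((2 + D) * M))"
        by (simp flip: exp_add)
      also have "\<dots> \<le> exp (\<beta> * norm (average f (bx l) - b)) * (3 / 2)"
        using \<beta>(2) by (intro mult_left_mono) auto
      finally show "?w a l \<le> 3 / 2 * ?w b l"
        by (metis (no_types, lifting) measure_nonneg mult.assoc mult.commute mult_left_mono)
    qed
    also have "\<dots> \<le> 3 / 2 * (3 / 2 * ?m j + 9 / (2 * M) * ?d b j)"
      unfolding gen_sum_cmult using Suc.IH[OF j, of b] M by (simp add: b_def)
    also have "\<dots> \<le> 3 / 2 * (3 / 2 * ?m j + 9 / (2 * M) * (M * ?m j))"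
      using osc[OF j] M by (intro mult_left_mono add_mono) (auto simp: b_def)
    \<comment> \<open>This fixes the constant \<open>9 / (2 * M)\<close>: recentring costs 3/2 *
      (3/2 + 9/2) = 9 times the measure of the child, which Chebyshev's inequality pays for as the
      average is more than \<open>2 * M\<close> away from \<open>a\<close>.\<close>
    also have "\<dots> = 9 / (2 * M) * (?m j * (2 * M))" using M by simp
    also have "\<dots> \<le> 9 / (2 * M) * (?m j * norm (b - a))"
      using False M by (intro mult_left_mono) (auto simp: b_def j_def)
    also have "\<dots> \<le> 9 / (2 * M) * ?d a j"
      using norm_average_minus_const_le[OF box_lmeasurable box_pos f, OF j j j, of a] M
      by (intro mult_left_mono) (auto simp: b_def)
    also have "\<dots> \<le> 3 / 2 * ?m j + 9 / (2 * M) * ?d a j" by simp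
    finally show ?thesis by (simp add: j_def)
  qed
  have "gen_sum (?w a) (Suc k) i \<le> (\<Sum>c\<in>C. 3 / 2 * ?m (child i c) + 9 / (2 * M) * ?d a (child i c))"
    using step by (auto intro: sum_mono)
  also have "\<dots> = 3 / 2 * ?m i + 9 / (2 * M) * ?d a i"
    using measure_children[OF Suc.prems(1)] set_integral_children[OF Suc.prems(1) d_int[OF Suc.prems(1)], of a]
    by (simp add: sum.distrib sum_distrib_left)
  finally show ?case .
qed

text \<open>At a point of the level set, either the average over its box of the \<open>k\<close>-th
  generation is at least \<open>\<gamma> / 2\<close> away from the root average, or \<open>f\<close>
  is at least \<open>\<gamma> / 2\<close> away from that average. The exponential moment bounds the
  first part; the second is a Chebyshev error that \<open>vanish\<close> makes arbitrarily
  small.\<close>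

theorem john_nirenberg:
  fixes f :: "'a \<Rightarrow> 'b::euclidean_space"
  assumes f: "\<And>j. j \<in> I \<Longrightarrow> set_integrable lebesgue (bx j) f"
    and M: "0 < M"
    and osc: "\<And>j. j \<in> I \<Longrightarrow>
      (LINT z:bx j|lebesgue. norm (f z - average f (bx j))) \<le> M * measure lebesgue (bx j)"
    and D: "0 \<le> D" and i: "i \<in> I" and \<gamma>: "0 < \<gamma>"
    and vanish: "\<And>e. 0 < e \<Longrightarrow>
      \<exists>k. gen_sum (\<lambda>j. LINT z:bx j|lebesgue. norm (f z - average f (bx j))) k i \<le> e"
  shows "measure lebesgue {z \<in> bx i. \<gamma> < norm (f z - average f (bx i))}
    \<le> 6 * exp (- (ln (3 / 2) / ((2 + D) * M) * \<gamma> / 2)) * measure lebesgue (bx i)"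
proof (rule field_le_epsilon)
  fix e :: real assume e: "0 < e"
  let ?m = "\<lambda>j. measure lebesgue (bx j)"
  \<comment> \<open>The largest rate for which recentring by \<open>(2 + D) * M\<close> costs at
    most a factor 3/2.\<close>
  define \<beta> where "\<beta> = ln (3 / 2) / ((2 + D) * M)"
  define a where "a = average f (bx i)"
  define S where "S = {z. \<gamma> < norm (f z - a)}"
  let ?osc = "\<lambda>j. LINT z:bx j|lebesgue. norm (f z - average f (bx j))"
  let ?w = "\<lambda>j. ?m j * exp (\<beta> * norm (average f (bx j) - a))"
  have \<beta>: "0 \<le> \<beta>" "exp (\<beta> * ((2 + D) * M)) \<le> 3 / 2"
    using M D by (auto simp: \<beta>_def)
  \<comment> \<open>The Chebyshev error carries the factor \<open>2 / \<gamma>\<close>, so this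
    leaves exactly \<open>e\<close>.\<close>
  obtain k where k: "gen_sum ?osc k i \<le> e * \<gamma> / 2"
    using vanish[of "e * \<gamma> / 2"] e \<gamma> by auto
  have S_lm: "bx j \<inter> S \<in> lmeasurable" if "j \<in> I" for j
    using superlevel_set_lmeasurable[OF box_lmeasurable f, OF that that, of \<gamma> a]
    by (simp add: S_def Collect_conj_eq)
  have ind: "set_integrable lebesgue (bx j) (indicat_real S)" if "j \<in> I" for j
    using S_lm[OF that] unfolding set_integrable_def real_scaleR_def indicator_inter_arith[symmetric]
    by (intro integrable_real_indicator) (auto simp: fmeasurable_def)
  have ind_eq: "(LINT z:bx j|lebesgue. indicat_real S z) = measure lebesgue (bx j \<inter> S)" for j
    unfolding set_lebesgue_integral_def by (simp flip: indicator_inter_arith)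
  have leaf: "(LINT z:bx j|lebesgue. indicat_real S z) \<le> exp (- (\<beta> * \<gamma> / 2)) * ?w j + 2 / \<gamma> * ?osc j"
    if j: "j \<in> I" for j
  proof -
    let ?c = "exp (- (\<beta> * \<gamma> / 2)) * exp (\<beta> * norm (average f (bx j) - a))"
    note lm = box_lmeasurable[OF j]
    have c: "set_integrable lebesgue (bx j) (\<lambda>_. ?c)"
      by (rule set_integrable_const_lmeasurable[OF lm])
    have o: "set_integrable lebesgue (bx j) (\<lambda>z. 2 / \<gamma> * norm (f z - average f (bx j)))"
      by (intro set_integrable_mult_right set_integrable_norm_diff f j set_integrable_const_lmeasurable lm)
    have "(LINT z:bx j|lebesgue. indicat_real S z)
        \<le> (LINT z:bx j|lebesgue. ?c + 2 / \<gamma> * norm (f z - average f (bx j)))"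
    proof (rule set_integral_mono[OF ind[OF j] set_integral_add(1)[OF c o]])
      fix z
      show "indicat_real S z \<le> ?c + 2 / \<gamma> * norm (f z - average f (bx j))"
      proof (cases "z \<in> S")
        case True
        then have "\<gamma> < norm (f z - average f (bx j)) + norm (average f (bx j) - a)"
          using norm_triangle_ineq[of "f z - average f (bx j)" "average f (bx j) - a"]
          by (simp add: S_def)
        then consider "\<gamma> / 2 \<le> norm (average f (bx j) - a)" | "\<gamma> / 2 \<le> norm (f z - average f (bx j))"
          by linarith
        then show ?thesis
        proof cases
          case 1
          then have "\<beta> * (\<gamma> / 2) \<le> \<beta> * norm (average f (bx j) - a)"
            using \<beta>(1) by (rule mult_left_mono)
          then have "1 \<le> ?c" by (simp flip: exp_add)
          moreover have "0 \<le> 2 / \<gamma> * norm (f z - average f (bx j))" using \<gamma> by simp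
          ultimately show ?thesis using True by simp
        next
          case 2
          then have "1 \<le> 2 / \<gamma> * norm (f z - average f (bx j))" using \<gamma> by (simp add: field_simps)
          moreover have "0 \<le> ?c" by simp
          ultimately show ?thesis using True by (simp del: exp_ge_zero)
        qed
      qed (use \<gamma> in auto)
    qed
    also have "\<dots> = exp (- (\<beta> * \<gamma> / 2)) * ?w j + 2 / \<gamma> * ?osc j"
      by (subst set_integral_add(2)[OF c o])
         (simp add: set_integral_const_lmeasurable[OF lm] mult_ac)
    finally show ?thesis .
  qed
  have "measure lebesgue (bx i \<inter> S) = gen_sum (\<lambda>j. LINT z:bx j|lebesgue. indicat_real S z) k i"
    using gen_sum_set_integral[OF i ind, of k] ind_eq[of i] by (metis (no_types, lifting))
  also have "\<dots> \<le> gen_sum (\<lambda>j. exp (- (\<beta> * \<gamma> / 2)) * ?w j + 2 / \<gamma> * ?osc j) k i"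
    by (rule gen_sum_mono[OF leaf i])
  also have "\<dots> = exp (- (\<beta> * \<gamma> / 2)) * gen_sum ?w k i + 2 / \<gamma> * gen_sum ?osc k i"
    by (simp only: gen_sum_add gen_sum_cmult)
  also have "\<dots> \<le> exp (- (\<beta> * \<gamma> / 2)) * (6 * ?m i) + 2 / \<gamma> * (e * \<gamma> / 2)"
  proof (intro add_mono mult_left_mono k)
    \<comment> \<open>Since \<open>a\<close> is the root average, the deviation from
      \<open>a\<close> is the oscillation itself, and the two summands are at most 3/2 and 9/2 times
      the measure.\<close>
    have "gen_sum ?w k i \<le> 3 / 2 * ?m i + 9 / (2 * M) * ?osc i"
      using gen_sum_exp_bound[OF f M osc \<beta> D i, of a k] M by (simp add: a_def)
    also have "\<dots> \<le> 3 / 2 * ?m i + 9 / (2 * M) * (M * ?m i)"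
      using M osc[OF i] by (intro add_left_mono mult_left_mono) auto
    finally show "gen_sum ?w k i \<le> 6 * ?m i" using M by simp
  qed (use \<gamma> in auto)
  also have "\<dots> = 6 * exp (- (\<beta> * \<gamma> / 2)) * ?m i + e" using \<gamma> by simp
  finally show "measure lebesgue {z \<in> bx i. \<gamma> < norm (f z - average f (bx i))}
      \<le> 6 * exp (- (ln (3 / 2) / ((2 + D) * M) * \<gamma> / 2)) * ?m i + e"
    by (simp add: S_def a_def \<beta>_def Collect_conj_eq)
qed

end

text \<open>Truncate first, then approximate: after truncation everything is bounded, so on the
  finite measure set \<open>S\<close> dominated convergence applies to continuous functions that
  converge only almost everywhere.\<close>

lemma continuous_L1_approximation:
  fixes f :: "'a::euclidean_space \<Rightarrow> 'b::euclidean_space"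
  assumes S: "S \<in> lmeasurable" and f: "set_integrable lebesgue S f" and e: "0 < e"
  obtains g where "continuous_on UNIV g" "set_integrable lebesgue S g"
    "(LINT z:S|lebesgue. norm (f z - g z)) \<le> e"
proof -
  define F where "F = (\<lambda>z. indicat_real S z *\<^sub>R f z)"
  have F_int: "integrable lebesgue F" using f by (simp add: set_integrable_def F_def)
  then have [measurable]: "F \<in> borel_measurable lebesgue" by simp
  have [measurable]: "S \<in> sets lebesgue" using S by (simp add: fmeasurable_def)
  \<comment> \<open>The radial retraction onto the ball of radius \<open>N\<close>. Being
    continuous, it can be applied to the approximants without destroying their continuity.\<close>
  define cl :: "real \<Rightarrow> 'b \<Rightarrow> 'b" where "cl = (\<lambda>N v. (N / max N (norm v)) *\<^sub>R v)"
  have cl_cont: "continuous_on UNIV (cl N)" if "0 < N" for N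
    unfolding cl_def using that by (intro continuous_intros) auto
  have cl_borel: "cl N \<in> borel_measurable borel" if "0 < N" for N
    using cl_cont[OF that] by (rule borel_measurable_continuous_onI)
  have cl_bound: "norm (cl N v) \<le> N" if "0 < N" for N v
    using that by (auto simp: cl_def max_def field_simps)
  have cl_id: "cl N v = v" if "norm v \<le> N" "0 < N" for N v
    using that by (simp add: cl_def max_def)
  have cl_diff: "norm (v - cl N v) \<le> norm v" if "0 < N" for N v
  proof -
    have "v - cl N v = (1 - N / max N (norm v)) *\<^sub>R v" by (simp add: cl_def scaleR_diff_left)
    moreover have "0 \<le> 1 - N / max N (norm v)" "1 - N / max N (norm v) \<le> 1"
      using that by auto
    ultimately show ?thesis by (simp add: mult_left_le_one_le)
  qed
  have "(\<lambda>n. LINT z|lebesgue. norm (F z - cl (real (Suc n)) (F z))) \<longlonglongrightarrow> (LINT z::'a|lebesgue. 0)"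
  proof (rule integral_dominated_convergence[where w = "\<lambda>z. norm (F z)"
        and s = "\<lambda>n z. norm (F z - cl (real (Suc n)) (F z))"])
    show "AE z in lebesgue. (\<lambda>n. norm (F z - cl (real (Suc n)) (F z))) \<longlonglongrightarrow> 0"
    proof (rule AE_I2)
      fix z
      have "\<forall>\<^sub>F n in sequentially. norm (F z - cl (real (Suc n)) (F z)) = 0"
        using eventually_ge_at_top[of "nat \<lceil>norm (F z)\<rceil>"]
        by eventually_elim (simp add: cl_id)
      then show "(\<lambda>n. norm (F z - cl (real (Suc n)) (F z))) \<longlonglongrightarrow> 0"
        by (rule tendsto_eventually)
    qed
    show "(\<lambda>z. norm (F z - cl (real (Suc n)) (F z))) \<in> borel_measurable lebesgue" for n
      using measurable_compose[OF _ cl_borel[of "real (Suc n)"], of F lebesgue] by simp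
  qed (use F_int cl_diff in \<open>auto simp del: of_nat_Suc\<close>)
  then have "\<forall>\<^sub>F n in sequentially. (LINT z|lebesgue. norm (F z - cl (real (Suc n)) (F z))) < e / 2"
    using e by (intro order_tendstoD(2)) auto
  then obtain n where n: "(LINT z|lebesgue. norm (F z - cl (real (Suc n)) (F z))) < e / 2"
    by (auto simp: eventually_sequentially)
  define N where "N = real (Suc n)"
  have N: "0 < N" by (simp add: N_def)
  have [measurable]: "cl N \<in> borel_measurable borel" by (rule cl_borel[OF N])
  \<comment> \<open>Yields continuous functions converging to \<open>F\<close> off a negligible set,
    with no control of their size; composing them with \<open>cl N\<close> supplies the
    bound.\<close>
  have "F measurable_on UNIV"
    by (rule lebesgue_measurable_imp_measurable_on) auto
  then obtain X g where X: "negligible X" and g: "\<And>k. continuous_on UNIV (g k)"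
    and g_lim: "\<And>z. z \<notin> X \<Longrightarrow> (\<lambda>k. g k z) \<longlonglongrightarrow> F z"
    by (auto simp: measurable_on_def)
  define h where "h = (\<lambda>k z. cl N (g k z))"
  have h_cont: "continuous_on UNIV (h k)" for k
    unfolding h_def using continuous_on_compose2[OF cl_cont[OF N] g] by auto
  have h_bound: "norm (h k z) \<le> N" for k z unfolding h_def by (rule cl_bound[OF N])
  have h_borel: "h k \<in> borel_measurable borel" for k
    by (rule borel_measurable_continuous_onI[OF h_cont])
  have [measurable]: "h k \<in> borel_measurable lebesgue" for k
    using measurable_completion[of "h k" lborel borel] h_borel by simp
  have N_int: "integrable lebesgue (\<lambda>z. indicat_real S z * c)" for c
    using set_integrable_const_lmeasurable[OF S, of c] by (simp add: set_integrable_def)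
  have h_int: "set_integrable lebesgue S (h k)" for k
    unfolding set_integrable_def
    by (rule Bochner_Integration.integrable_bound[OF N_int[of N]])
       (use h_bound N in \<open>auto simp: indicator_def\<close>)
  have cl_F_int: "set_integrable lebesgue S (\<lambda>z. cl N (F z))"
    unfolding set_integrable_def
    by (rule Bochner_Integration.integrable_bound[OF N_int[of N]])
       (use cl_bound[OF N] N in \<open>auto simp: indicator_def\<close>)
  have "(\<lambda>k. LINT z:S|lebesgue. norm (cl N (F z) - h k z)) \<longlonglongrightarrow> (LINT z::'a|lebesgue. 0)"
    unfolding set_lebesgue_integral_def
  proof (rule integral_dominated_convergence[where w = "\<lambda>z. indicat_real S z * (2 * N)"
        and s = "\<lambda>k z. indicat_real S z *\<^sub>R norm (cl N (F z) - h k z)"])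
    have "AE z in lebesgue. z \<notin> X"
      using X by (simp add: negligible_iff_null_sets AE_not_in)
    then show "AE z in lebesgue. (\<lambda>k. indicat_real S z *\<^sub>R norm (cl N (F z) - h k z)) \<longlonglongrightarrow> 0"
    proof eventually_elim
      fix z assume "z \<notin> X"
      then have "(\<lambda>k. h k z) \<longlonglongrightarrow> cl N (F z)"
        unfolding h_def using g_lim cl_cont[OF N]
        by (metis UNIV_I continuous_on_eq_continuous_at isCont_tendsto_compose open_UNIV)
      from tendsto_norm[OF tendsto_diff[OF tendsto_const[of "cl N (F z)"] this]]
      have "(\<lambda>k. norm (cl N (F z) - h k z)) \<longlonglongrightarrow> 0" by simp
      from tendsto_scaleR[OF tendsto_const[of "indicat_real S z"] this]
      show "(\<lambda>k. indicat_real S z *\<^sub>R norm (cl N (F z) - h k z)) \<longlonglongrightarrow> 0" by simp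
    qed
    have "norm (cl N (F z) - h k z) \<le> 2 * N" for k z
      using norm_triangle_ineq4[of "cl N (F z)" "h k z"] cl_bound[OF N, of "F z"] h_bound[of k z] by linarith
    then show "AE z in lebesgue. norm (indicat_real S z *\<^sub>R norm (cl N (F z) - h k z)) \<le> indicat_real S z * (2 * N)" for k
      by (auto simp: indicator_def)
  qed (use N_int in auto)
  then have "\<forall>\<^sub>F k in sequentially. (LINT z:S|lebesgue. norm (cl N (F z) - h k z)) < e / 2"
    using e by (intro order_tendstoD(2)) auto
  then obtain k where k: "(LINT z:S|lebesgue. norm (cl N (F z) - h k z)) < e / 2"
    by (auto simp: eventually_sequentially)
  have fF: "set_integrable lebesgue S F"
    using f by (simp add: set_integrable_def F_def flip: indicator_inter_arith)
  have "(LINT z:S|lebesgue. norm (f z - h k z))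
      \<le> (LINT z:S|lebesgue. norm (F z - cl N (F z)) + norm (cl N (F z) - h k z))"
  proof (intro set_integral_mono set_integral_add(1) set_integrable_norm_diff f fF cl_F_int h_int)
    fix z assume "z \<in> S"
    then show "norm (f z - h k z) \<le> norm (F z - cl N (F z)) + norm (cl N (F z) - h k z)"
      using norm_triangle_ineq[of "F z - cl N (F z)" "cl N (F z) - h k z"] by (simp add: F_def)
  qed
  also have "\<dots> = (LINT z:S|lebesgue. norm (F z - cl N (F z))) + (LINT z:S|lebesgue. norm (cl N (F z) - h k z))"
    by (intro set_integral_add(2) set_integrable_norm_diff fF cl_F_int h_int)
  \<comment> \<open>Outside \<open>S\<close> both \<open>F\<close> and its truncation
    vanish.\<close>
  also have "(LINT z:S|lebesgue. norm (F z - cl N (F z))) = (LINT z|lebesgue. norm (F z - cl N (F z)))"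
    unfolding set_lebesgue_integral_def
    by (rule Bochner_Integration.integral_cong) (auto simp: F_def indicator_def cl_def)
  finally have "(LINT z:S|lebesgue. norm (f z - h k z)) \<le> e"
    using n k by (simp add: N_def)
  then show thesis using that h_cont h_int by blast
qed

section \<open>Vanishing of the mean oscillation over fine generations\<close>

context dyadic_tree
begin

text \<open>Write \<open>f\<close> as a continuous \<open>g\<close> plus a remainder small in L1. On
  boxes of small diameter \<open>g\<close> is nearly constant, while the cost of the remainder adds
  up over a generation to the same integral for every \<open>k\<close>.\<close>

lemma gen_sum_osc_vanishes:
  fixes f :: "'a \<Rightarrow> 'b::euclidean_space"
  assumes f: "\<And>j. j \<in> I \<Longrightarrow> set_integrable lebesgue (bx j) f"
    and cpt: "\<And>j. j \<in> I \<Longrightarrow> compact (bx j)"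
    and sz: "\<And>j z w. j \<in> I \<Longrightarrow> z \<in> bx j \<Longrightarrow> w \<in> bx j \<Longrightarrow> dist z w \<le> sz j"
    and sz_child: "\<And>j c. j \<in> I \<Longrightarrow> c \<in> C \<Longrightarrow> sz (child j c) \<le> sz j / 2"
    and i: "i \<in> I" and e: "0 < e"
  shows "\<exists>k. gen_sum (\<lambda>j. LINT z:bx j|lebesgue. norm (f z - average f (bx j))) k i \<le> e"
proof -
  let ?osc = "\<lambda>j. LINT z:bx j|lebesgue. norm (f z - average f (bx j))"
  obtain g where g: "continuous_on UNIV g"
    and g_approx: "(LINT z:bx i|lebesgue. norm (f z - g z)) \<le> e / 4"
    using continuous_L1_approximation[OF box_lmeasurable[OF i] f[OF i], of "e / 4"] e by auto
  have g_int: "set_integrable lebesgue (bx j) g" if "j \<in> I" for j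
  proof -
    have "set_integrable lborel (bx j) g"
      unfolding set_integrable_def
      using borel_integrable_compact[OF cpt[OF that] continuous_on_subset[OF g]]
      by (simp add: indicator_scaleR_eq_if)
    then show ?thesis
      unfolding set_integrable_def by (simp add: integrable_completion borel_measurable_integrable)
  qed
  \<comment> \<open>Half of \<open>e\<close> pays for \<open>f - g\<close>, as twice
    \<open>e / 4\<close>; the other half pays for the oscillation of \<open>g\<close>, as
    \<open>2 * \<eta>\<close> times the measure of the root box.\<close>
  define \<eta> where "\<eta> = e / (4 * measure lebesgue (bx i))"
  have \<eta>: "0 < \<eta>" using e box_pos[OF i] by (simp add: \<eta>_def)
  have "uniformly_continuous_on (bx i) g"
    using compact_uniformly_continuous[OF continuous_on_subset[OF g] cpt[OF i]] by simp
  then obtain \<delta> where \<delta>: "0 < \<delta>" and g_unif: "\<And>z w. z \<in> bx i \<Longrightarrow> w \<in> bx i \<Longrightarrow> dist w z < \<delta> \<Longrightarrow> dist (g w) (g z) < \<eta>"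
    unfolding uniformly_continuous_on_def using \<eta> by metis
  obtain k where k: "sz i / \<delta> < 2 ^ k" using real_arch_pow[of 2] by auto
  define u where "u = (\<lambda>z. 2 * norm (f z - g z) + 2 * \<eta>)"
  have u_int: "set_integrable lebesgue (bx j) u" if "j \<in> I" for j
    unfolding u_def
    by (intro set_integral_add(1) set_integrable_mult_right set_integrable_norm_diff f g_int that
        set_integrable_const_lmeasurable box_lmeasurable)
  have leaf: "?osc j \<le> (LINT z:bx j|lebesgue. u z)" if j: "j \<in> I" "bx j \<subseteq> bx i" "sz j < \<delta>" for j
  proof -
    obtain w where w: "w \<in> bx j" using box_pos[OF j(1)] by (cases "bx j = {}") auto
    \<comment> \<open>The value of \<open>g\<close> at an arbitrary point of the box stands in for
      the average of \<open>f\<close>.\<close>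
    have "?osc j \<le> 2 * (LINT z:bx j|lebesgue. norm (f z - g w))"
      by (intro osc_le_twice_deviation box_lmeasurable box_pos f j)
    also have "\<dots> = (LINT z:bx j|lebesgue. 2 * norm (f z - g w))"
      by simp
    also have "\<dots> \<le> (LINT z:bx j|lebesgue. u z)"
    proof (intro set_integral_mono u_int set_integrable_mult_right set_integrable_norm_diff f j
        set_integrable_const_lmeasurable box_lmeasurable)
      fix z assume z: "z \<in> bx j"
      have "dist (g z) (g w) < \<eta>"
        using g_unif[of w z] z w j sz[OF j(1) z w] by force
      then show "2 * norm (f z - g w) \<le> u z"
        using norm_triangle_ineq[of "f z - g z" "g z - g w"] by (simp add: u_def dist_norm)
    qed
    finally show ?thesis .
  qed
  \<comment> \<open>Stated for all boxes inside the root: each generation halves both sides of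
    \<open>sz j / \<delta> < 2 ^ k\<close>, until at \<open>k = 0\<close> it says that the box is
    smaller than \<open>\<delta>\<close>.\<close>
  have "gen_sum ?osc k j \<le> gen_sum (\<lambda>j. LINT z:bx j|lebesgue. u z) k j"
    if "j \<in> I" "bx j \<subseteq> bx i" "sz j / \<delta> < 2 ^ k" for j
    using that
  proof (induction k arbitrary: j)
    case 0
    then show ?case using leaf \<delta> by simp
  next
    case (Suc k j)
    show ?case unfolding gen_sum.simps
    proof (rule sum_mono)
      fix c assume c: "c \<in> C"
      have "sz (child j c) / \<delta> \<le> (sz j / \<delta>) / 2"
        using divide_right_mono[OF sz_child[OF Suc.prems(1) c], of \<delta>] \<delta> by simp
      then have "sz (child j c) / \<delta> < 2 ^ k" using Suc.prems(3) by simp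
      then show "gen_sum ?osc k (child j c) \<le> gen_sum (\<lambda>j. LINT z:bx j|lebesgue. u z) k (child j c)"
        using Suc.IH[of "child j c"] child_in[OF Suc.prems(1) c] child_subset[OF Suc.prems(1) c] Suc.prems(2)
        by blast
    qed
  qed
  from this[OF i order_refl k] have "gen_sum ?osc k i \<le> (LINT z:bx i|lebesgue. u z)"
    by (simp add: gen_sum_set_integral i u_int)
  also have "\<dots> = 2 * (LINT z:bx i|lebesgue. norm (f z - g z)) + 2 * \<eta> * measure lebesgue (bx i)"
    unfolding u_def
    by (subst set_integral_add(2))
       (auto simp: set_integral_const_lmeasurable box_lmeasurable i
         intro!: set_integrable_mult_right set_integrable_norm_diff f g_int set_integrable_const_lmeasurable)
  also have "2 * \<eta> * measure lebesgue (bx i) = e / 2"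
    using box_pos[OF i] by (simp add: \<eta>_def)
  finally show ?thesis using g_approx by (intro exI[of _ k]) linarith
qed

end

section \<open>Rectangles and little bmo\<close>

lemma mem_cube: "z \<in> cube x r \<longleftrightarrow> (\<forall>i. x $ i - r / 2 \<le> z $ i \<and> z $ i \<le> x $ i + r / 2)"
  by (simp add: cube_def mem_box_cart)

lemma measure_cube:
  fixes x :: "real^'d"
  assumes "0 < r"
  shows "measure lebesgue (cube x r) = r ^ CARD('d)"
proof -
  have "x \<in> cube x r" using assms by (simp add: mem_cube)
  then show ?thesis
    unfolding cube_def by (subst measure_completion, simp, subst content_cbox_cart) auto
qed

lemma rectangle_eq_cbox:
  "cube x r \<times> cube y s = cbox (\<chi> i. x $ i - r / 2, \<chi> i. y $ i - s / 2) (\<chi> i. x $ i + r / 2, \<chi> i. y $ i + s / 2)"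
  by (simp add: cube_def cbox_Pair_eq)

lemma measure_rectangle:
  "measure lebesgue (cube x r \<times> cube y s) = measure lebesgue (cube x r) * measure lebesgue (cube y s)"
  unfolding rectangle_eq_cbox by (simp add: content_Pair cube_def)

lemma cube_lmeasurable: "cube x r \<in> lmeasurable"
  by (simp add: cube_def)

lemma rectangle_lmeasurable: "cube x r \<times> cube y s \<in> lmeasurable"
  by (simp add: rectangle_eq_cbox)

text \<open>The directions from the centre of a cube to the centres of its 2^d halved
  subcubes.\<close>

definition signs :: "(real^'d) set" where
  "signs = {\<sigma>. \<forall>i. \<sigma> $ i \<in> {-1, 1}}"

lemma finite_signs: "finite (signs :: (real^'d) set)"
proof -
  have "(signs :: (real^'d) set) \<subseteq> (\<lambda>f. \<chi> i. f i) ` (UNIV \<rightarrow>\<^sub>E {-1, 1})"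
  proof
    fix \<sigma> :: "real^'d" assume "\<sigma> \<in> signs"
    then have "\<sigma> = (\<chi> i. \<sigma> $ i)" "($) \<sigma> \<in> UNIV \<rightarrow>\<^sub>E {-1, 1}"
      by (auto simp: signs_def)
    then show "\<sigma> \<in> (\<lambda>f. \<chi> i. f i) ` (UNIV \<rightarrow>\<^sub>E {-1, 1})" by blast
  qed
  then show ?thesis by (rule finite_subset) (intro finite_imageI finite_PiE, auto)
qed

lemma cube_child_subset:
  assumes "\<sigma> \<in> signs" "0 < r"
  shows "cube (x + (r / 4) *\<^sub>R \<sigma>) (r / 2) \<subseteq> cube x r"
proof
  fix z assume z: "z \<in> cube (x + (r / 4) *\<^sub>R \<sigma>) (r / 2)"
  show "z \<in> cube x r" unfolding mem_cube
  proof
    fix i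
    have "\<sigma> $ i \<in> {-1, 1}" using assms(1) by (simp add: signs_def)
    moreover have "x $ i + r / 4 * \<sigma> $ i - r / 2 / 2 \<le> z $ i \<and> z $ i \<le> x $ i + r / 4 * \<sigma> $ i + r / 2 / 2"
      using z by (simp add: mem_cube)
    ultimately show "x $ i - r / 2 \<le> z $ i \<and> z $ i \<le> x $ i + r / 2" using assms(2) by auto
  qed
qed

text \<open>Off the hyperplanes through the centre, the signs of the coordinates of
  \<open>z - x\<close> single out the only child that can contain \<open>z\<close>.\<close>

lemma indicator_cube_children:
  fixes x z :: "real^'d"
  assumes r: "0 < r" and z: "\<And>i. z $ i \<noteq> x $ i"
  shows "indicat_real (cube x r) z = (\<Sum>\<sigma>\<in>signs. indicat_real (cube (x + (r / 4) *\<^sub>R \<sigma>) (r / 2)) z)"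
proof -
  define \<tau> :: "real^'d" where "\<tau> = (\<chi> i. sgn (z $ i - x $ i))"
  have \<tau>: "\<tau> \<in> signs" using z by (auto simp: \<tau>_def signs_def sgn_real_def)
  have mem: "z \<in> cube (x + (r / 4) *\<^sub>R \<sigma>) (r / 2) \<longleftrightarrow> \<sigma> = \<tau> \<and> z \<in> cube x r" if \<sigma>: "\<sigma> \<in> signs" for \<sigma>
  proof
    assume m: "z \<in> cube (x + (r / 4) *\<^sub>R \<sigma>) (r / 2)"
    have "\<sigma> $ i = \<tau> $ i" for i
    proof -
      have "\<sigma> $ i \<in> {-1, 1}" using \<sigma> by (simp add: signs_def)
      moreover have "x $ i + r / 4 * \<sigma> $ i - r / 2 / 2 \<le> z $ i \<and> z $ i \<le> x $ i + r / 4 * \<sigma> $ i + r / 2 / 2"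
        using m by (simp add: mem_cube)
      ultimately show ?thesis using z[of i] by (auto simp: \<tau>_def sgn_real_def)
    qed
    then show "\<sigma> = \<tau> \<and> z \<in> cube x r"
      using m cube_child_subset[OF \<sigma> r] by (auto simp: vec_eq_iff)
  next
    assume m: "\<sigma> = \<tau> \<and> z \<in> cube x r"
    show "z \<in> cube (x + (r / 4) *\<^sub>R \<sigma>) (r / 2)" unfolding mem_cube
    proof
      fix i
      have "x $ i - r / 2 \<le> z $ i \<and> z $ i \<le> x $ i + r / 2" using m by (simp add: mem_cube)
      then show "(x + (r / 4) *\<^sub>R \<sigma>) $ i - r / 2 / 2 \<le> z $ i \<and> z $ i \<le> (x + (r / 4) *\<^sub>R \<sigma>) $ i + r / 2 / 2"
        using m r z[of i] by (auto simp: \<tau>_def sgn_real_def)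
    qed
  qed
  have "(\<Sum>\<sigma>\<in>signs. indicat_real (cube (x + (r / 4) *\<^sub>R \<sigma>) (r / 2)) z)
      = (\<Sum>\<sigma>\<in>signs. if \<sigma> = \<tau> then indicat_real (cube x r) z else 0)"
    by (rule sum.cong) (auto simp: mem indicator_def)
  also have "\<dots> = indicat_real (cube x r) z"
    using \<tau> by (simp add: finite_signs)
  finally show ?thesis ..
qed

lemma dist_cube_le:
  fixes x :: "real^'d" and r :: real
  assumes "z \<in> cube x r" "w \<in> cube x r"
  shows "dist z w \<le> real CARD('d) * r"
proof -
  have "norm (z - w) \<le> (\<Sum>i\<in>UNIV. \<bar>(z - w) $ i\<bar>)" by (rule norm_le_l1_cart)
  also have "\<dots> \<le> (\<Sum>i\<in>(UNIV :: 'd set). r)"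
  proof (rule sum_mono)
    fix i
    have "x $ i - r / 2 \<le> z $ i \<and> z $ i \<le> x $ i + r / 2" "x $ i - r / 2 \<le> w $ i \<and> w $ i \<le> x $ i + r / 2"
      using assms by (auto simp: mem_cube)
    then show "\<bar>(z - w) $ i\<bar> \<le> r" unfolding vector_minus_component abs_le_iff by linarith
  qed
  finally show ?thesis by (simp add: dist_norm)
qed

section \<open>Rectangles as a dyadic tree\<close>

type_synonym ('n, 'm) rect = "(real^'n) \<times> real \<times> (real^'m) \<times> real"

definition rects :: "('n::finite, 'm::finite) rect set" where
  "rects = {(x, r, y, s). 0 < r \<and> 0 < s}"

fun rect_set :: "('n::finite, 'm::finite) rect \<Rightarrow> ((real^'n) \<times> (real^'m)) set" where
  "rect_set (x, r, y, s) = cube x r \<times> cube y s"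

text \<open>Halving both side lengths at once keeps each factor a cube and also halves the
  diameter.\<close>

fun rect_child :: "('n::finite, 'm::finite) rect \<Rightarrow> (real^'n) \<times> (real^'m) \<Rightarrow> ('n, 'm) rect" where
  "rect_child (x, r, y, s) (\<sigma>, \<tau>) = (x + (r / 4) *\<^sub>R \<sigma>, r / 2, y + (s / 4) *\<^sub>R \<tau>, s / 2)"

lemma AE_coordinates_ne:
  fixes x :: "real^'n" and y :: "real^'m"
  shows "AE z in lebesgue. (\<forall>i. fst z $ i \<noteq> x $ i) \<and> (\<forall>j. snd z $ j \<noteq> y $ j)"
proof -
  have "negligible ((\<Union>i. {z. z \<bullet> (axis i 1, 0) = x $ i}) \<union> (\<Union>j. {z. z \<bullet> (0, axis j 1) = y $ j})
      :: ((real^'n) \<times> (real^'m)) set)"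
    by (intro negligible_Un negligible_Union) (auto simp: Basis_prod_def axis_in_Basis_iff)
  then have "(\<Union>i. {z. z \<bullet> (axis i 1, 0) = x $ i}) \<union> (\<Union>j. {z. z \<bullet> (0, axis j 1) = y $ j})
      \<in> null_sets (lebesgue :: ((real^'n) \<times> (real^'m)) measure)"
    by (simp add: negligible_iff_null_sets)
  from AE_not_in[OF this] show ?thesis
    by eventually_elim (auto simp: inner_prod_def inner_axis)
qed

text \<open>The splitting is the product of the splittings of the two cubes. All 2^(n+m) children
  have equal measure, so the comparison with the parent holds with equality for this
  \<open>D\<close>.\<close>

interpretation rect_tree: dyadic_tree "rects :: ('n::finite, 'm::finite) rect set"
    rect_set "signs \<times> signs" rect_child "2 ^ (CARD('n) + CARD('m))"
proof unfold_locales
  fix j :: "('n, 'm) rect"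
  assume "j \<in> rects"
  then obtain x r y s where j: "j = (x, r, y, s)" "0 < r" "0 < s" by (auto simp: rects_def)
  show "rect_set j \<in> lmeasurable" by (simp add: j rectangle_lmeasurable)
  show "0 < measure lebesgue (rect_set j)" by (simp add: j measure_rectangle measure_cube)
  show "AE z in lebesgue. indicat_real (rect_set j) z
      = (\<Sum>c\<in>signs \<times> signs. indicat_real (rect_set (rect_child j c)) z)"
    using AE_coordinates_ne[of x y]
  proof eventually_elim
    fix z :: "(real^'n) \<times> (real^'m)"
    assume z: "(\<forall>i. fst z $ i \<noteq> x $ i) \<and> (\<forall>j. snd z $ j \<noteq> y $ j)"
    have ind: "indicat_real (A \<times> B) z = indicat_real A (fst z) * indicat_real B (snd z)"
      for A :: "(real^'n) set" and B :: "(real^'m) set"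
      by (cases z) (auto simp: indicator_def)
    have "(\<Sum>c\<in>signs \<times> signs. indicat_real (rect_set (rect_child j c)) z)
        = (\<Sum>(\<sigma>, \<tau>)\<in>signs \<times> signs. indicat_real (cube (x + (r / 4) *\<^sub>R \<sigma>) (r / 2)) (fst z)
            * indicat_real (cube (y + (s / 4) *\<^sub>R \<tau>) (s / 2)) (snd z))"
      by (intro sum.cong refl) (auto simp: j(1) ind)
    also have "\<dots> = indicat_real (cube x r) (fst z) * indicat_real (cube y s) (snd z)"
      using z by (simp add: indicator_cube_children[OF j(2)] indicator_cube_children[OF j(3)]
          sum_product sum.cartesian_product)
    also have "\<dots> = indicat_real (rect_set j) z" by (simp add: j(1) ind)
    finally show "indicat_real (rect_set j) z
        = (\<Sum>c\<in>signs \<times> signs. indicat_real (rect_set (rect_child j c)) z)" ..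
  qed
  fix c :: "(real^'n) \<times> (real^'m)"
  assume c: "c \<in> signs \<times> signs"
  obtain \<sigma> \<tau> where c': "c = (\<sigma>, \<tau>)" "\<sigma> \<in> signs" "\<tau> \<in> signs" using c by auto
  show "rect_child j c \<in> rects" using j(2,3) by (simp add: j(1) c'(1) rects_def)
  show "rect_set (rect_child j c) \<subseteq> rect_set j"
    using cube_child_subset[OF c'(2) j(2)] cube_child_subset[OF c'(3) j(3)] by (auto simp: j c')
  show "measure lebesgue (rect_set j) \<le> 2 ^ (CARD('n) + CARD('m)) * measure lebesgue (rect_set (rect_child j c))"
    using j(2,3) by (simp add: j(1) c'(1) measure_rectangle measure_cube power_divide power_add)
qed

section \<open>From the little bmo norm to exponential decay of level sets\<close>

lemma lp_norm_1:
  "lp_norm 1 g = (\<integral>\<^sup>+ z. ennreal (norm (g z)) \<partial>lebesgue)"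
  by (simp add: lp_norm_def epowr_def powr_one ennreal_enn2real_if)

text \<open>Translates the quotient of extended norms into real integrals; finiteness of
  \<open>bmo_norm f\<close> ensures that \<open>enn2real\<close> loses nothing.\<close>

lemma bmo_oscillation_le:
  fixes f :: "(real^'n) \<times> (real^'m) \<Rightarrow> 'b::euclidean_space" and x :: "real^'n" and y :: "real^'m"
  assumes f: "f \<in> bmo" and r: "0 < r" and s: "0 < s"
  defines "R \<equiv> cube x r \<times> cube y s"
  shows "(LINT z:R|lebesgue. norm (f z - average f R)) \<le> enn2real (bmo_norm f) * measure lebesgue R"
proof -
  have R: "R \<in> rectangles" "R \<in> lmeasurable"
    using r s unfolding R_def rectangles_def by (blast, simp add: rectangle_lmeasurable)
  have pos: "0 < measure lebesgue R" using r s by (simp add: R_def measure_rectangle measure_cube)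
  have f_int: "set_integrable lebesgue R f"
    using f unfolding bmo_def locally_integrable_def R_def rectangle_eq_cbox by auto
  note d = set_integrable_norm_diff[OF f_int set_integrable_const_lmeasurable[OF R(2)]]
  have "lp_norm 1 (restr (\<lambda>z. f z - average f R) R)
      = (\<integral>\<^sup>+ z. ennreal (indicat_real R z *\<^sub>R norm (f z - average f R)) \<partial>lebesgue)"
    by (simp add: lp_norm_1 restr_def)
  also have "\<dots> = ennreal (LINT z:R|lebesgue. norm (f z - average f R))"
    unfolding set_lebesgue_integral_def
    by (intro nn_integral_eq_integral) (use d in \<open>auto simp: set_integrable_def\<close>)
  finally have 1: "lp_norm 1 (restr (\<lambda>z. f z - average f R) R) = ennreal (LINT z:R|lebesgue. norm (f z - average f R))" .
  have "lp_norm 1 (indicat_real R) = (\<integral>\<^sup>+ z. indicator R z \<partial>lebesgue)"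
    by (simp add: lp_norm_1 flip: ennreal_indicator)
  also have "\<dots> = ennreal (measure lebesgue R)"
    using R(2) by (simp add: emeasure_eq_measure2)
  finally have 2: "lp_norm 1 (indicat_real R) = ennreal (measure lebesgue R)" .
  have fin: "bmo_norm f < \<infinity>" using f by (simp add: bmo_def)
  have "lp_norm 1 (restr (\<lambda>z. f z - average f R) R) / lp_norm 1 (indicat_real R) \<le> bmo_norm f"
    unfolding bmo_norm_def by (rule SUP_upper[OF R(1)])
  also have "\<dots> = ennreal (enn2real (bmo_norm f))" using fin by (simp add: top.not_eq_extremum)
  finally show ?thesis
    unfolding 1 2 using pos
    by (simp add: divide_ennreal set_lebesgue_integral_def Bochner_Integration.integral_nonneg field_simps)
qed

theorem bmo_john_nirenberg:
  fixes f :: "(real^'n) \<times> (real^'m) \<Rightarrow> 'b::euclidean_space"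
  assumes f: "f \<in> bmo" and R: "R \<in> rectangles" and \<gamma>: "0 < \<gamma>"
  shows "measure lebesgue {z \<in> R. \<gamma> < norm (f z - average f R)}
    \<le> 6 * exp (- (ln (3 / 2) / ((2 + 2 ^ (CARD('n) + CARD('m))) * enn2real (bmo_norm f)) * \<gamma> / 2))
      * measure lebesgue R"
proof -
  obtain x :: "real^'n" and y :: "real^'m" and r s
    where R_eq: "R = rect_set (x, r, y, s)" and rs: "0 < r" "0 < s"
    using R by (auto simp: rectangles_def)
  have f_int: "set_integrable lebesgue (rect_set j) f" if "j \<in> rects" for j :: "('n, 'm) rect"
    using f unfolding bmo_def locally_integrable_def
    by (cases j) (auto simp: rectangle_eq_cbox)
  \<comment> \<open>A diameter bound coming from the sum norm; passing to a child halves it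
    exactly.\<close>
  define sz :: "('n, 'm) rect \<Rightarrow> real"
    where "sz = (\<lambda>(x, r, y, s). real CARD('n) * r + real CARD('m) * s)"
  show ?thesis
  proof (cases "enn2real (bmo_norm f) = 0")
    \<comment> \<open>Division by zero yields 0, so the exponential is 1 and the measure of
      \<open>R\<close> is bound enough.\<close>
    case True
    have "measure lebesgue {z \<in> R. \<gamma> < norm (f z - average f R)} \<le> measure lebesgue R"
      using superlevel_set_lmeasurable[of R f \<gamma> "average f R"] f_int[of "(x, r, y, s)"] rs
      by (intro measure_mono_fmeasurable) (auto simp: R_eq rects_def rectangle_lmeasurable)
    also have "\<dots> \<le> 6 * measure lebesgue R" by simp
    finally show ?thesis by (simp add: True)
  next
    case False
    then have M: "0 < enn2real (bmo_norm f)" by (simp add: less_le)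
    show ?thesis unfolding R_eq
    proof (rule rect_tree.john_nirenberg[OF f_int M _ _ _ \<gamma>])
      fix j :: "('n, 'm) rect" assume "j \<in> rects"
      then show "(LINT z:rect_set j|lebesgue. norm (f z - average f (rect_set j)))
          \<le> enn2real (bmo_norm f) * measure lebesgue (rect_set j)"
        using bmo_oscillation_le[OF f] by (auto simp: rects_def)
    next
      fix e :: real assume "0 < e"
      then show "\<exists>k. rect_tree.gen_sum (\<lambda>j. LINT z:rect_set j|lebesgue. norm (f z - average f (rect_set j))) k (x, r, y, s) \<le> e"
      proof (rule rect_tree.gen_sum_osc_vanishes[OF f_int, where sz = sz, rotated -1])
        fix j :: "('n, 'm) rect" and z w assume j: "j \<in> rects" and zw: "z \<in> rect_set j" "w \<in> rect_set j"
        obtain x r y s where j': "j = (x, r, y, s)" by (cases j)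
        have "dist z w \<le> dist (fst z) (fst w) + dist (snd z) (snd w)"
          by (simp add: dist_prod_def sqrt_add_le_add_sqrt order_trans[OF sqrt_add_le_add_sqrt])
        also have "\<dots> \<le> sz j"
          using zw unfolding sz_def j' by (auto intro!: add_mono dist_cube_le)
        finally show "dist z w \<le> sz j" .
      qed (use rs in \<open>auto simp: sz_def rectangle_eq_cbox rects_def\<close>)
    qed (use rs in \<open>auto simp: rects_def\<close>)
  qed
qed

section \<open>Morrey--Herz norms of indicator functions\<close>

lemma epowr_ennreal: "0 \<le> x \<Longrightarrow> epowr (ennreal x) a = ennreal (x powr a)"
  by (simp add: epowr_def)

lemma epowr_mono:
  assumes "0 \<le> a" "x \<le> y"
  shows "epowr x a \<le> epowr y a"
proof (cases "y = \<infinity>")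
  case False
  then have "x \<noteq> \<infinity>" using assms(2) by (auto simp: top_unique)
  then show ?thesis using False assms
    by (auto simp: epowr_def top.not_eq_extremum intro!: ennreal_leI powr_mono2 enn2real_mono)
qed (simp add: epowr_def)

lemma lp_norm_indicator:
  assumes "S \<in> lmeasurable"
  shows "lp_norm p (indicat_real S) = ennreal (measure lebesgue S powr (1 / p))"
proof -
  have "(\<integral>\<^sup>+ z. ennreal (norm (indicat_real S z) powr p) \<partial>lebesgue) = (\<integral>\<^sup>+ z. indicator S z \<partial>lebesgue)"
    by (rule nn_integral_cong) (simp add: indicator_def)
  also have "\<dots> = ennreal (measure lebesgue S)"
    using assms by (simp add: emeasure_eq_measure2)
  finally show ?thesis by (simp add: lp_norm_def epowr_ennreal)
qed

lemma restr_indicator: "restr (indicat_real E) S = indicat_real (E \<inter> S)"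
  by (auto simp: restr_def indicator_def)

lemma sets_dyadic [measurable]:
  "dyadic_cube k \<in> sets borel" "dyadic_shell k \<in> sets borel"
  by (auto simp: dyadic_cube_def dyadic_shell_def cube_def)

lemma Times_sets_lebesgue:
  fixes S :: "'a::euclidean_space set" and T :: "'b::euclidean_space set"
  assumes "S \<in> sets borel" "T \<in> sets borel"
  shows "S \<times> T \<in> sets lebesgue"
  using borel_Times[OF assms] by (simp add: sets_completionI_sets)

lemma measure_lebesgue_Times:
  fixes S :: "'a::euclidean_space set" and T :: "'b::euclidean_space set"
  assumes S: "S \<in> sets borel" and T: "T \<in> sets borel"
  shows "measure lebesgue (S \<times> T) = measure lebesgue S * measure lebesgue T"
proof -
  have "emeasure lborel (S \<times> T) = emeasure lborel S * emeasure lborel T"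
    using lborel.emeasure_pair_measure_Times[of S lborel T] S T by (simp add: lborel_prod)
  then have "measure lborel (S \<times> T) = measure lborel S * measure lborel T"
    by (simp add: measure_def enn2real_mult)
  then show ?thesis using S T borel_Times[OF S T] by (simp add: measure_completion)
qed

lemma herz_norm_indicator:
  fixes E :: "((real^'n) \<times> (real^'m)) set"
  assumes E: "E \<in> lmeasurable"
  shows "herz_norm \<alpha> p q (indicat_real E) = epowr (\<Sum>\<^sub>\<infinity>(i, j)\<in>UNIV.
    ennreal (2 powr (real_of_int (i + j) * q * \<alpha>)
      * measure lebesgue (E \<inter> dyadic_shell i \<times> dyadic_shell j) powr (q / p))) (1 / q)"
proof -
  have "E \<inter> dyadic_shell i \<times> dyadic_shell j \<in> lmeasurable" for i j
    using E Times_sets_lebesgue[OF sets_dyadic(2) sets_dyadic(2)] by (rule fmeasurable_Int_fmeasurable)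
  then show ?thesis
    by (simp add: herz_norm_def restr_indicator lp_norm_indicator epowr_ennreal powr_powr
        ennreal_mult' divide_inverse mult.commute)
qed

section \<open>Position of a cube relative to the dyadic cubes and shells\<close>

lemma dyadic_cube_mono:
  assumes "i \<le> j"
  shows "dyadic_cube i \<subseteq> dyadic_cube j"
proof
  have le: "2 powr real_of_int i \<le> 2 powr real_of_int j" using assms by simp
  fix z assume z: "z \<in> dyadic_cube i"
  show "z \<in> dyadic_cube j" unfolding dyadic_cube_def mem_cube
  proof
    fix l
    have "0 $ l - 2 powr real_of_int i / 2 \<le> z $ l \<and> z $ l \<le> 0 $ l + 2 powr real_of_int i / 2"
      using z unfolding dyadic_cube_def mem_cube by blast
    then show "0 $ l - 2 powr real_of_int j / 2 \<le> z $ l \<and> z $ l \<le> 0 $ l + 2 powr real_of_int j / 2"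
      using le by linarith
  qed
qed

lemma dyadic_shell_Int_cube:
  assumes "j < i"
  shows "dyadic_shell i \<inter> dyadic_cube j = {}"
  using dyadic_cube_mono[of j "i - 1"] assms by (auto simp: dyadic_shell_def)

lemma cube_Int_dyadic_lmeasurable: "cube x r \<inter> dyadic_cube i \<in> lmeasurable" "cube x r \<inter> dyadic_shell i \<in> lmeasurable"
  by (auto intro!: fmeasurable_Int_fmeasurable cube_lmeasurable sets_completionI_sets)

text \<open>
  Let \<open>k\<close> be minimal with \<open>cube x r \<subseteq> dyadic_cube k\<close>. If the cube meets \<open>dyadic_cube i\<close> with \<open>i\<close> much
  smaller than \<open>k\<close>, then \<open>r\<close> is comparable to \<open>2 ^ k\<close>.
\<close>

lemma cube_dyadic_scale:
  fixes x :: "real^'d"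
  assumes r: "0 < r"
  obtains k :: int where "cube x r \<subseteq> dyadic_cube k"
    and "\<And>i. measure lebesgue (cube x r \<inter> dyadic_cube i)
      \<le> 8 ^ CARD('d) * 2 powr (real CARD('d) * (real_of_int i - real_of_int k)) * measure lebesgue (cube x r)"
proof -
  \<comment> \<open>In coordinate \<open>j\<close> the centre is farthest from the origin, so
    \<open>\<rho>\<close> is half the side length of the smallest centred cube containing the given
    one.\<close>
  obtain j where j: "\<And>i. \<bar>x $ i\<bar> \<le> \<bar>x $ j\<bar>"
  proof -
    have "Max (range (\<lambda>i. \<bar>x $ i\<bar>)) \<in> range (\<lambda>i. \<bar>x $ i\<bar>)" by (intro Max_in) auto
    then obtain j where "Max (range (\<lambda>i. \<bar>x $ i\<bar>)) = \<bar>x $ j\<bar>" by blast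
    then show thesis using that Max_ge[of "range (\<lambda>i. \<bar>x $ i\<bar>)"] by (metis finite_imageI finite rangeI)
  qed
  define \<rho> where "\<rho> = \<bar>x $ j\<bar> + r / 2"
  have \<rho>: "0 < \<rho>" using r by (simp add: \<rho>_def add_nonneg_pos)
  \<comment> \<open>Rounding up gives \<open>2 * \<rho> \<le> P\<close> for the inclusion and
    \<open>P < 4 * \<rho>\<close> for minimality.\<close>
  define k where "k = \<lceil>log 2 (2 * \<rho>)\<rceil>"
  define P where "P = 2 powr real_of_int k"
  have "log 2 (2 * \<rho>) \<le> real_of_int k" by (simp add: k_def)
  then have k1: "2 * \<rho> \<le> P"
    using \<rho> unfolding P_def by (subst (asm) log_le_iff) auto
  have "real_of_int k < log 2 (2 * \<rho>) + 1" unfolding k_def by linarith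
  also have "\<dots> = log 2 (4 * \<rho>)" using \<rho> log_mult_pos[of 2 "2 * \<rho>" 2] by simp
  finally have k2: "P < 4 * \<rho>"
    using \<rho> unfolding P_def by (subst (asm) less_log_iff) auto
  show thesis
  proof
    show "cube x r \<subseteq> dyadic_cube k"
    proof
      fix z assume z: "z \<in> cube x r"
      show "z \<in> dyadic_cube k" unfolding dyadic_cube_def mem_cube P_def[symmetric]
      proof
        fix i
        have "x $ i - r / 2 \<le> z $ i \<and> z $ i \<le> x $ i + r / 2" using z by (simp add: mem_cube)
        then have "\<bar>z $ i\<bar> \<le> \<rho>" using j[of i] unfolding \<rho>_def by linarith
        then show "0 $ i - P / 2 \<le> z $ i \<and> z $ i \<le> 0 $ i + P / 2" using k1 by (simp add: abs_le_iff)
      qed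
    qed
    fix i :: int
    let ?n = "CARD('d)"
    define X where "X = 2 powr (real_of_int i - real_of_int k)"
    have X: "0 < X" by (simp add: X_def)
    have Q: "2 powr real_of_int i = X * P" by (simp add: X_def P_def flip: powr_add)
    have "8 ^ ?n * 2 powr (real ?n * (real_of_int i - real_of_int k)) = (8 * X) ^ ?n"
      by (simp add: X_def power_mult_distrib powr_powr mult.commute flip: powr_realpow)
    moreover have "measure lebesgue (cube x r \<inter> dyadic_cube i) \<le> (8 * X) ^ ?n * measure lebesgue (cube x r)"
    proof (cases "1 \<le> 8 * X")
      case True
      have "measure lebesgue (cube x r \<inter> dyadic_cube i) \<le> measure lebesgue (cube x r)"
        using cube_Int_dyadic_lmeasurable(1)[of x r i] cube_lmeasurable[of x r]
        by (intro measure_mono_fmeasurable) (auto simp: fmeasurableD)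
      also have "\<dots> \<le> (8 * X) ^ ?n * measure lebesgue (cube x r)"
        using one_le_power[OF True, of ?n] by (simp add: mult_le_cancel_right1)
      finally show ?thesis .
    next
      case False
      show ?thesis
      proof (cases "cube x r \<inter> dyadic_cube i = {}")
        case True
        then show ?thesis using X by simp
      next
        case nonempty: False
        then obtain z where z: "z \<in> cube x r" "z \<in> dyadic_cube i" by auto
        have "x $ j - r / 2 \<le> z $ j \<and> z $ j \<le> x $ j + r / 2" using z(1) by (simp add: mem_cube)
        moreover have "- (X * P / 2) \<le> z $ j \<and> z $ j \<le> X * P / 2"
          using z(2) by (simp add: dyadic_cube_def mem_cube Q)
        ultimately have "\<rho> \<le> X * P / 2 + r" unfolding \<rho>_def by linarith
        moreover have "X * P \<le> 1 / 8 * P" using False by (intro mult_right_mono) (auto simp: P_def)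
        \<comment> \<open>Here \<open>\<rho> \<le> P / 16 + r\<close> and
          \<open>P < 4 * \<rho>\<close>, hence \<open>3 / 4 * P < 4 * r\<close>.\<close>
        ultimately have "P \<le> 8 * r" using k2 r by linarith
        then have "X * P \<le> 8 * X * r" using X by simp
        then have "(X * P) ^ ?n \<le> (8 * X * r) ^ ?n" using X by (intro power_mono) (auto simp: P_def)
        moreover have "measure lebesgue (cube x r \<inter> dyadic_cube i) \<le> (X * P) ^ ?n"
        proof -
          have "measure lebesgue (cube x r \<inter> dyadic_cube i) \<le> measure lebesgue (dyadic_cube i :: (real^'d) set)"
            using cube_Int_dyadic_lmeasurable(1)[of x r i]
            by (intro measure_mono_fmeasurable) (auto simp: fmeasurableD dyadic_cube_def cube_lmeasurable)
          also have "\<dots> = (X * P) ^ ?n" using X by (simp add: dyadic_cube_def Q measure_cube P_def)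
          finally show ?thesis .
        qed
        ultimately show ?thesis using r by (simp add: measure_cube power_mult_distrib)
      qed
    qed
    ultimately show "measure lebesgue (cube x r \<inter> dyadic_cube i)
        \<le> 8 ^ ?n * 2 powr (real ?n * (real_of_int i - real_of_int k)) * measure lebesgue (cube x r)"
      by simp
  qed
qed

text \<open>At most half of the measure lies in \<open>dyadic_cube (k - 4)\<close>. The other half
  is spread over four shells, one of which carries at least a quarter of it.\<close>

lemma cube_dyadic_shell:
  fixes x :: "real^'d"
  assumes r: "0 < r" and k: "cube x r \<subseteq> dyadic_cube k"
    and le: "\<And>i. measure lebesgue (cube x r \<inter> dyadic_cube i)
      \<le> 8 ^ CARD('d) * 2 powr (real CARD('d) * (real_of_int i - real_of_int k)) * measure lebesgue (cube x r)"
  obtains i where "k - 3 \<le> i" "i \<le> k" "measure lebesgue (cube x r) / 8 \<le> measure lebesgue (cube x r \<inter> dyadic_shell i)"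
proof -
  let ?n = "CARD('d)"
  let ?a = "measure lebesgue (cube x r)"
  let ?m = "\<lambda>i. measure lebesgue (cube x r \<inter> dyadic_cube i)"
  let ?s = "\<lambda>i. measure lebesgue (cube x r \<inter> dyadic_shell i)"
  have step: "?m i \<le> ?m (i - 1) + ?s i" for i
  proof -
    have "?m i \<le> measure lebesgue ((cube x r \<inter> dyadic_cube (i - 1)) \<union> (cube x r \<inter> dyadic_shell i))"
      by (intro measure_mono_fmeasurable fmeasurable.Un cube_Int_dyadic_lmeasurable fmeasurableD)
         (auto simp: dyadic_shell_def)
    also have "\<dots> \<le> ?m (i - 1) + ?s i"
      by (intro measure_Un_le fmeasurableD cube_Int_dyadic_lmeasurable)
    finally show ?thesis .
  qed
  have top: "?m k = ?a" using k by (simp add: Int_absorb2)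
  have bot: "?m (k - 4) \<le> ?a / 2"
  proof -
    \<comment> \<open>Four steps below \<open>k\<close> suffice because 8 * 2^(-4) = 1/2 and the
      dimension is at least 1.\<close>
    have "(8::real) ^ ?n * 2 powr (real ?n * (real_of_int (k - 4) - real_of_int k)) = 8 ^ ?n * (2 powr (-4)) ^ ?n"
      by (simp add: powr_powr mult.commute flip: powr_realpow)
    also have "\<dots> = (8 * 2 powr (-4)) ^ ?n" by (simp add: power_mult_distrib)
    also have "\<dots> = (1 / 2) ^ ?n" by (simp add: powr_minus)
    also have "\<dots> \<le> (1 / 2) ^ 1"
      by (intro power_decreasing) (auto simp: Suc_leI)
    finally show ?thesis
      using order_trans[OF le[of "k - 4"] mult_right_mono[of _ "1/2" ?a]] by simp
  qed
  have "?a / 2 \<le> ?s k + ?s (k - 1) + ?s (k - 2) + ?s (k - 3)"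
    using step[of k] step[of "k - 1"] step[of "k - 2"] step[of "k - 3"] top bot by simp
  then have "?a / 8 \<le> ?s k \<or> ?a / 8 \<le> ?s (k - 1) \<or> ?a / 8 \<le> ?s (k - 2) \<or> ?a / 8 \<le> ?s (k - 3)"
    by linarith
  then show thesis using that[of k] that[of "k - 1"] that[of "k - 2"] that[of "k - 3"] by auto
qed

section \<open>Upper bound for indicators of small subsets of a rectangle\<close>

lemma geometric_sum_below:
  fixes k :: int
  assumes s: "0 < s" and F: "finite F"
  shows "(\<Sum>i\<in>F. if i \<le> k then 2 powr (s * (real_of_int i - real_of_int k)) else 0) \<le> 1 / (1 - 2 powr (- s))"
proof -
  have x: "0 < 2 powr (- s)" "2 powr (- s) < (1::real)" using s powr_less_mono[of "- s" 0 2] by auto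
  have inj: "inj_on (\<lambda>i. nat (k - i)) {i\<in>F. i \<le> k}" by (auto simp: inj_on_def)
  have "(\<Sum>i\<in>F. if i \<le> k then 2 powr (s * (real_of_int i - real_of_int k)) else 0)
      = (\<Sum>i\<in>{i\<in>F. i \<le> k}. 2 powr (s * (real_of_int i - real_of_int k)))"
    using F by (simp add: sum.inter_filter)
  also have "\<dots> = (\<Sum>i\<in>{i\<in>F. i \<le> k}. (2 powr (- s)) ^ nat (k - i))"
    by (intro sum.cong refl) (simp add: powr_powr algebra_simps flip: powr_realpow)
  also have "\<dots> = (\<Sum>l\<in>(\<lambda>i. nat (k - i)) ` {i\<in>F. i \<le> k}. (2 powr (- s)) ^ l)"
    by (simp add: sum.reindex[OF inj])
  also have "\<dots> \<le> (\<Sum>l. (2 powr (- s)) ^ l)"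
    using x F by (intro sum_le_suminf summable_geometric) auto
  also have "\<dots> = 1 / (1 - 2 powr (- s))"
    using x by (intro suminf_geometric) auto
  finally show ?thesis .
qed

text \<open>
  Interpolating \<open>measure E = measure E powr \<theta> * measure E powr (1 - \<theta>)\<close> keeps a power of the small
  factor \<open>\<epsilon>\<close> while \<open>s\<^sub>1, s\<^sub>2 > 0\<close> still make the sum over the shells a convergent geometric series.
\<close>

lemma morrey_herz_indicator_le:
  fixes E :: "((real^'n) \<times> (real^'m)) set" and x :: "real^'n" and y :: "real^'m"
    and \<alpha> lam p q \<theta> :: real and k l :: int
  assumes p: "0 < p" and q: "0 < q" and lam: "0 \<le> lam" and \<theta>: "0 \<le> \<theta>" "\<theta> \<le> 1"
  defines "t \<equiv> (1 - \<theta>) / p"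
  defines "s\<^sub>1 \<equiv> q * (\<alpha> - lam + real CARD('n) * t)" and "s\<^sub>2 \<equiv> q * (\<alpha> - lam + real CARD('m) * t)"
  assumes s1: "0 < s\<^sub>1" and s2: "0 < s\<^sub>2"
    and r: "0 < r" and s: "0 < s"
    and E: "E \<in> lmeasurable" "E \<subseteq> cube x r \<times> cube y s"
    and small: "measure lebesgue E \<le> \<epsilon> * measure lebesgue (cube x r \<times> cube y s)" and \<epsilon>: "0 < \<epsilon>"
    and k: "cube x r \<subseteq> dyadic_cube k"
    and scale_k: "\<And>i. measure lebesgue (cube x r \<inter> dyadic_cube i)
      \<le> 8 ^ CARD('n) * 2 powr (real CARD('n) * (real_of_int i - real_of_int k)) * measure lebesgue (cube x r)"
    and l: "cube y s \<subseteq> dyadic_cube l"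
    and scale_l: "\<And>i. measure lebesgue (cube y s \<inter> dyadic_cube i)
      \<le> 8 ^ CARD('m) * 2 powr (real CARD('m) * (real_of_int i - real_of_int l)) * measure lebesgue (cube y s)"
  shows "morrey_herz_norm \<alpha> lam p q (indicat_real E)
    \<le> ennreal ((8 ^ CARD('n) * 8 ^ CARD('m)) powr t
        * (1 / (1 - 2 powr (- s\<^sub>1)) * (1 / (1 - 2 powr (- s\<^sub>2)))) powr (1 / q)
        * \<epsilon> powr (\<theta> / p)
        * (2 powr (real_of_int (k + l) * (\<alpha> - lam)) * measure lebesgue (cube x r \<times> cube y s) powr (1 / p)))"
    (is "_ \<le> ennreal ?B")
proof -
  define a where "a = measure lebesgue (cube x r)"
  define b where "b = measure lebesgue (cube y s)"
  have ab: "0 < a" "0 < b" using r s by (auto simp: a_def b_def measure_cube)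
  have ab_eq: "measure lebesgue (cube x r \<times> cube y s) = a * b"
    by (simp add: measure_rectangle a_def b_def)
  define K :: real where "K = 8 ^ CARD('n) * 8 ^ CARD('m)"
  have K: "0 < K" by (simp add: K_def)
  define G where "G = 1 / (1 - 2 powr (- s\<^sub>1)) * (1 / (1 - 2 powr (- s\<^sub>2)))"
  have G: "0 < G" using s1 s2 powr_less_mono[of "- s\<^sub>1" 0 2] powr_less_mono[of "- s\<^sub>2" 0 2] by (simp add: G_def)
  \<comment> \<open>The \<open>q\<close>-th power of the claimed bound without the geometric factor
    \<open>G\<close>. The factor \<open>W\<close> below is the \<open>q\<close>-th power of the
    inverse Morrey weight.\<close>
  define Z where "Z = 2 powr (real_of_int (k + l) * (\<alpha> - lam) * q) * K powr (t * q)
    * \<epsilon> powr (\<theta> / p * q) * (a * b) powr (1 / p * q)"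
  have Z: "0 < Z" using K \<epsilon> ab by (simp add: Z_def)
  let ?u = "\<lambda>i. if i \<le> k then 2 powr (s\<^sub>1 * (real_of_int i - real_of_int k)) else 0"
  let ?v = "\<lambda>j. if j \<le> l then 2 powr (s\<^sub>2 * (real_of_int j - real_of_int l)) else 0"
  have t_eq: "\<theta> / p * q + t * q = 1 / p * q" using p by (simp add: t_def field_simps)
  have "ennreal (2 powr (- (real_of_int (L1 + L2) * lam)))
      * herz_norm \<alpha> p q (restr (indicat_real E) (dyadic_cube L1 \<times> dyadic_cube L2)) \<le> ennreal ?B" for L1 L2
  proof -
    define W where "W = 2 powr (real_of_int (L1 + L2) * lam * q)"
    let ?e = "\<lambda>i j. measure lebesgue (E \<inter> dyadic_cube L1 \<times> dyadic_cube L2 \<inter> dyadic_shell i \<times> dyadic_shell j)"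
    have term_le: "2 powr (real_of_int (i + j) * q * \<alpha>) * ?e i j powr (q / p) \<le> W * Z * (?u i * ?v j)" for i j
    proof (cases "i \<le> k \<and> j \<le> l \<and> i \<le> L1 \<and> j \<le> L2")
      \<comment> \<open>A shell lying outside one of the four dyadic cubes that contain the factors
        of the set contributes nothing.\<close>
      case False
      have "E \<inter> dyadic_cube L1 \<times> dyadic_cube L2 \<inter> dyadic_shell i \<times> dyadic_shell j = {}"
      proof (rule equals0I)
        fix z assume z: "z \<in> E \<inter> dyadic_cube L1 \<times> dyadic_cube L2 \<inter> dyadic_shell i \<times> dyadic_shell j"
        then have "fst z \<in> cube x r" "snd z \<in> cube y s" using E(2) by auto
        then have "fst z \<in> dyadic_shell i \<inter> dyadic_cube k" "fst z \<in> dyadic_shell i \<inter> dyadic_cube L1"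
          "snd z \<in> dyadic_shell j \<inter> dyadic_cube l" "snd z \<in> dyadic_shell j \<inter> dyadic_cube L2"
          using z k l by auto
        then show False
          using False dyadic_shell_Int_cube by (metis empty_iff linorder_not_le)
      qed
      then show ?thesis using Z by (simp add: W_def)
    next
      case True
      let ?S = "E \<inter> dyadic_cube L1 \<times> dyadic_cube L2 \<inter> dyadic_shell i \<times> dyadic_shell j"
      define e where "e = ?e i j"
      have S: "?S \<in> lmeasurable"
        by (intro fmeasurable_Int_fmeasurable E(1) Times_sets_lebesgue sets_dyadic)
      have e1: "e \<le> \<epsilon> * (a * b)"
      proof -
        have "e \<le> measure lebesgue E"
          unfolding e_def using E(1) S by (intro measure_mono_fmeasurable) (auto simp: fmeasurableD)
        then show ?thesis using small by (simp add: ab_eq)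
      qed
      define X where "X = 2 powr (real CARD('n) * (real_of_int i - real_of_int k)
        + real CARD('m) * (real_of_int j - real_of_int l))"
      have e2: "e \<le> K * X * (a * b)"
      proof -
        let ?A = "cube x r \<inter> dyadic_cube i" and ?B = "cube y s \<inter> dyadic_cube j"
        have AB: "?A \<in> sets borel" "?B \<in> sets borel" by (auto simp: cube_def dyadic_cube_def)
        have "?A \<times> ?B \<in> lmeasurable"
          by (rule fmeasurableI2[OF rectangle_lmeasurable[of x r y s]]) (use Times_sets_lebesgue[OF AB] in auto)
        then have "e \<le> measure lebesgue (?A \<times> ?B)"
          unfolding e_def using E(2) S by (intro measure_mono_fmeasurable) (auto simp: fmeasurableD dyadic_shell_def)
        also have "\<dots> = measure lebesgue ?A * measure lebesgue ?B"
          by (rule measure_lebesgue_Times[OF AB])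
        also have "\<dots> \<le> (8 ^ CARD('n) * 2 powr (real CARD('n) * (real_of_int i - real_of_int k)) * a)
            * (8 ^ CARD('m) * 2 powr (real CARD('m) * (real_of_int j - real_of_int l)) * b)"
          using ab by (intro mult_mono) (use scale_k scale_l in \<open>auto simp: a_def b_def\<close>)
        also have "\<dots> = K * X * (a * b)"
          by (simp add: K_def X_def powr_add mult_ac)
        finally show ?thesis .
      qed
      have e0: "0 \<le> e" by (simp add: e_def)
      have X0: "0 < X" by (simp add: X_def)
      \<comment> \<open>The share \<open>\<theta> / p * q\<close> of the exponent is estimated by
        \<open>e1\<close>, the share \<open>t * q\<close> by \<open>e2\<close>.\<close>
      have "e powr (q / p) = e powr (\<theta> / p * q) * e powr (t * q)"
        using t_eq by (simp flip: powr_add)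
      also have "\<dots> \<le> (\<epsilon> * (a * b)) powr (\<theta> / p * q) * (K * X * (a * b)) powr (t * q)"
        using e0 e1 e2 p q \<theta> by (intro mult_mono powr_mono2) (auto simp: t_def)
      also have "\<dots> = K powr (t * q) * \<epsilon> powr (\<theta> / p * q) * (a * b) powr (1 / p * q) * X powr (t * q)"
      proof -
        have "(\<epsilon> * (a * b)) powr (\<theta> / p * q) * (K * X * (a * b)) powr (t * q)
            = \<epsilon> powr (\<theta> / p * q) * (a * b) powr (\<theta> / p * q)
              * (K powr (t * q) * X powr (t * q) * (a * b) powr (t * q))"
          by (simp only: powr_mult[of \<epsilon>] powr_mult[of "K * X"] powr_mult[of K])
        also have "\<dots> = K powr (t * q) * \<epsilon> powr (\<theta> / p * q)
            * ((a * b) powr (\<theta> / p * q) * (a * b) powr (t * q)) * X powr (t * q)"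
          by (simp only: mult_ac)
        also have "(a * b) powr (\<theta> / p * q) * (a * b) powr (t * q) = (a * b) powr (1 / p * q)"
          by (simp only: powr_add[symmetric] t_eq)
        finally show ?thesis .
      qed
      finally have e3: "e powr (q / p) \<le> K powr (t * q) * \<epsilon> powr (\<theta> / p * q) * (a * b) powr (1 / p * q) * X powr (t * q)" .
      \<comment> \<open>Since \<open>lam\<close> is nonnegative, this part of the weight is at most
        \<open>W\<close>, which the Morrey factor cancels. The remaining weight with
        \<open>\<alpha> - lam\<close> gives a bound uniform in \<open>L1\<close> and
        \<open>L2\<close>.\<close>
      have "real_of_int (i + j) * lam * q \<le> real_of_int (L1 + L2) * lam * q"
        using True lam q by (intro mult_right_mono) auto
      then have "real_of_int (i + j) * q * \<alpha> \<le> real_of_int (L1 + L2) * lam * q + real_of_int (i + j) * (\<alpha> - lam) * q"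
        by (simp add: algebra_simps)
      then have w: "2 powr (real_of_int (i + j) * q * \<alpha>) \<le> W * 2 powr (real_of_int (i + j) * (\<alpha> - lam) * q)"
        unfolding W_def powr_add[symmetric] by (intro powr_mono) auto
      have "2 powr (real_of_int (i + j) * q * \<alpha>) * e powr (q / p)
          \<le> (W * 2 powr (real_of_int (i + j) * (\<alpha> - lam) * q))
            * (K powr (t * q) * \<epsilon> powr (\<theta> / p * q) * (a * b) powr (1 / p * q) * X powr (t * q))"
        using w e3 by (intro mult_mono) (auto simp: W_def)
      also have "\<dots> = W * (K powr (t * q) * \<epsilon> powr (\<theta> / p * q) * (a * b) powr (1 / p * q))
          * (2 powr (real_of_int (i + j) * (\<alpha> - lam) * q) * X powr (t * q))"
        by (simp add: mult_ac)
      also have "2 powr (real_of_int (i + j) * (\<alpha> - lam) * q) * X powr (t * q)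
          = 2 powr (real_of_int (k + l) * (\<alpha> - lam) * q) * (?u i * ?v j)"
      proof -
        have "?u i * ?v j = 2 powr (s\<^sub>1 * (real_of_int i - real_of_int k) + s\<^sub>2 * (real_of_int j - real_of_int l))"
          using True by (simp add: powr_add)
        moreover have "real_of_int (i + j) * (\<alpha> - lam) * q + (real CARD('n) * (real_of_int i - real_of_int k)
            + real CARD('m) * (real_of_int j - real_of_int l)) * (t * q)
          = real_of_int (k + l) * (\<alpha> - lam) * q
            + (s\<^sub>1 * (real_of_int i - real_of_int k) + s\<^sub>2 * (real_of_int j - real_of_int l))"
          by (simp add: s\<^sub>1_def s\<^sub>2_def algebra_simps)
        ultimately show ?thesis by (simp only: X_def powr_powr powr_add[symmetric])
      qed
      finally show ?thesis by (simp add: e_def Z_def mult_ac)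
    qed
    \<comment> \<open>Finite partial sums suffice, as an infinite sum of extended nonnegative
      numbers is their supremum.\<close>
    have sum_le: "(\<Sum>(i, j)\<in>F. ennreal (2 powr (real_of_int (i + j) * q * \<alpha>) * ?e i j powr (q / p))) \<le> ennreal (W * Z * G)"
      if F: "finite F" for F
    proof -
      have ennreal_sum: "(\<Sum>(i, j)\<in>F. ennreal (2 powr (real_of_int (i + j) * q * \<alpha>) * ?e i j powr (q / p)))
          = ennreal (\<Sum>(i, j)\<in>F. 2 powr (real_of_int (i + j) * q * \<alpha>) * ?e i j powr (q / p))"
        by (subst sum_ennreal[symmetric]) (auto simp: split_def)
      have "(\<Sum>(i, j)\<in>F. 2 powr (real_of_int (i + j) * q * \<alpha>) * ?e i j powr (q / p))
          \<le> (\<Sum>(i, j)\<in>F. W * Z * (?u i * ?v j))"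
        unfolding split_def by (rule sum_mono) (rule term_le)
      \<comment> \<open>Enlarging \<open>F\<close> to the product of its projections makes the
        double sum factor.\<close>
      also have "\<dots> \<le> (\<Sum>(i, j)\<in>fst ` F \<times> snd ` F. W * Z * (?u i * ?v j))"
      proof (rule sum_mono2)
        show "0 \<le> (case z of (i, j) \<Rightarrow> W * Z * (?u i * ?v j))" for z
          using Z by (cases z) (simp add: W_def)
      qed (use F in force)+
      also have "\<dots> = W * Z * (sum ?u (fst ` F) * sum ?v (snd ` F))"
        by (simp only: sum_product sum.cartesian_product) (simp only: sum_distrib_left split_def)
      also have "\<dots> \<le> W * Z * G"
        unfolding G_def using Z F s1 s2 powr_less_mono[of "- s\<^sub>1" 0 2]
        by (intro mult_left_mono mult_mono geometric_sum_below sum_nonneg) (auto simp: W_def)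
      finally show ?thesis unfolding ennreal_sum by (rule ennreal_leI)
    qed
    have "restr (indicat_real E) (dyadic_cube L1 \<times> dyadic_cube L2) = indicat_real (E \<inter> dyadic_cube L1 \<times> dyadic_cube L2)"
      by (rule restr_indicator)
    moreover have "E \<inter> dyadic_cube L1 \<times> dyadic_cube L2 \<in> lmeasurable"
      by (intro fmeasurable_Int_fmeasurable E(1) Times_sets_lebesgue sets_dyadic)
    ultimately have "herz_norm \<alpha> p q (restr (indicat_real E) (dyadic_cube L1 \<times> dyadic_cube L2))
        = epowr (\<Sum>\<^sub>\<infinity>(i, j)\<in>UNIV. ennreal (2 powr (real_of_int (i + j) * q * \<alpha>) * ?e i j powr (q / p))) (1 / q)"
      by (simp only: herz_norm_indicator)
    also have "\<dots> \<le> epowr (ennreal (W * Z * G)) (1 / q)"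
    proof (rule epowr_mono)
      show "(\<Sum>\<^sub>\<infinity>(i, j)\<in>UNIV. ennreal (2 powr (real_of_int (i + j) * q * \<alpha>) * ?e i j powr (q / p))) \<le> ennreal (W * Z * G)"
        by (subst nonneg_infsum_complete) (auto intro!: SUP_least simp only: sum_le mem_Collect_eq zero_le)
    qed (use q in simp)
    also have "\<dots> = ennreal ((W * Z * G) powr (1 / q))"
      using Z G by (intro epowr_ennreal) (simp add: W_def)
    finally have le: "herz_norm \<alpha> p q (restr (indicat_real E) (dyadic_cube L1 \<times> dyadic_cube L2))
        \<le> ennreal ((W * Z * G) powr (1 / q))" .
    have WZG: "(W * Z * G) powr (1 / q) = 2 powr (real_of_int (L1 + L2) * lam) * ?B"
    proof -
      have "W powr (1 / q) = 2 powr (real_of_int (L1 + L2) * lam)"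
        using q by (simp add: W_def powr_powr)
      moreover have "Z powr (1 / q) = 2 powr (real_of_int (k + l) * (\<alpha> - lam)) * K powr t
          * \<epsilon> powr (\<theta> / p) * (a * b) powr (1 / p)"
        unfolding Z_def using q K \<epsilon> ab by (simp add: powr_mult powr_powr)
      moreover have "(W * Z * G) powr (1 / q) = W powr (1 / q) * Z powr (1 / q) * G powr (1 / q)"
        by (simp only: powr_mult)
      ultimately have "(W * Z * G) powr (1 / q) = 2 powr (real_of_int (L1 + L2) * lam)
          * (2 powr (real_of_int (k + l) * (\<alpha> - lam)) * K powr t * \<epsilon> powr (\<theta> / p) * (a * b) powr (1 / p))
          * G powr (1 / q)"
        by (simp only:)
      then show ?thesis unfolding ab_eq K_def[symmetric] G_def[symmetric] by (simp only: mult_ac)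
    qed
    have "ennreal (2 powr (- (real_of_int (L1 + L2) * lam)))
        * herz_norm \<alpha> p q (restr (indicat_real E) (dyadic_cube L1 \<times> dyadic_cube L2))
        \<le> ennreal (2 powr (- (real_of_int (L1 + L2) * lam))) * ennreal (2 powr (real_of_int (L1 + L2) * lam) * ?B)"
      using le unfolding WZG by (rule mult_left_mono) simp
    also have "\<dots> = ennreal ?B"
      by (simp add: powr_minus flip: ennreal_mult' mult.assoc)
    finally show ?thesis .
  qed
  then show ?thesis
    unfolding morrey_herz_norm_def by (auto intro!: SUP_least)
qed

text \<open>One term is enough: choose shells \<open>i\<close>, \<open>j\<close> carrying a fixed
  proportion of the two cubes and use the same pair as Morrey indices. They are within 3 of
  \<open>k\<close> and \<open>l\<close>, so the weights agree up to a constant.\<close>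

lemma morrey_herz_rectangle_ge:
  fixes x :: "real^'n" and y :: "real^'m"
    and \<alpha> lam p q :: real and k l :: int
  assumes p: "0 < p" and q: "0 < q"
    and r: "0 < r" and s: "0 < s"
    and k: "cube x r \<subseteq> dyadic_cube k"
    and scale_k: "\<And>i. measure lebesgue (cube x r \<inter> dyadic_cube i)
      \<le> 8 ^ CARD('n) * 2 powr (real CARD('n) * (real_of_int i - real_of_int k)) * measure lebesgue (cube x r)"
    and l: "cube y s \<subseteq> dyadic_cube l"
    and scale_l: "\<And>i. measure lebesgue (cube y s \<inter> dyadic_cube i)
      \<le> 8 ^ CARD('m) * 2 powr (real CARD('m) * (real_of_int i - real_of_int l)) * measure lebesgue (cube y s)"
  shows "ennreal (2 powr (- 6 * \<bar>\<alpha> - lam\<bar>) * (1 / 64) powr (1 / p)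
      * (2 powr (real_of_int (k + l) * (\<alpha> - lam)) * measure lebesgue (cube x r \<times> cube y s) powr (1 / p)))
    \<le> morrey_herz_norm \<alpha> lam p q (indicat_real (cube x r \<times> cube y s))" (is "ennreal ?B \<le> _")
proof -
  let ?R = "cube x r \<times> cube y s"
  obtain i where i: "k - 3 \<le> i" "i \<le> k"
    and i_le: "measure lebesgue (cube x r) / 8 \<le> measure lebesgue (cube x r \<inter> dyadic_shell i)"
    by (rule cube_dyadic_shell[OF r k scale_k])
  obtain j where j: "l - 3 \<le> j" "j \<le> l"
    and j_le: "measure lebesgue (cube y s) / 8 \<le> measure lebesgue (cube y s \<inter> dyadic_shell j)"
    by (rule cube_dyadic_shell[OF s l scale_l])
  let ?e = "\<lambda>i' j'. measure lebesgue (?R \<inter> dyadic_cube i \<times> dyadic_cube j \<inter> dyadic_shell i' \<times> dyadic_shell j')"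
  have set_eq: "?R \<inter> dyadic_cube i \<times> dyadic_cube j \<inter> dyadic_shell i \<times> dyadic_shell j
      = (cube x r \<inter> dyadic_shell i) \<times> (cube y s \<inter> dyadic_shell j)"
    by (auto simp: dyadic_shell_def)
  have "measure lebesgue ?R / 64 = (measure lebesgue (cube x r) / 8) * (measure lebesgue (cube y s) / 8)"
    by (simp add: measure_rectangle)
  also have "\<dots> \<le> measure lebesgue (cube x r \<inter> dyadic_shell i) * measure lebesgue (cube y s \<inter> dyadic_shell j)"
    by (intro mult_mono i_le j_le) auto
  also have "\<dots> = ?e i j"
    unfolding set_eq by (rule measure_lebesgue_Times[symmetric]) (auto simp: cube_def)
  finally have e: "measure lebesgue ?R / 64 \<le> ?e i j" .
  \<comment> \<open>Each index loses at most 3, whence the 6; the absolute value covers both signs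
    of \<open>\<alpha> - lam\<close>.\<close>
  have "2 powr (- 6 * \<bar>\<alpha> - lam\<bar>) * 2 powr (real_of_int (k + l) * (\<alpha> - lam)) \<le> 2 powr (real_of_int (i + j) * (\<alpha> - lam))"
    unfolding powr_add[symmetric]
  proof (rule powr_mono)
    have "\<bar>real_of_int (k + l) - real_of_int (i + j)\<bar> \<le> 6" using i j by linarith
    then have "\<bar>real_of_int (k + l) - real_of_int (i + j)\<bar> * \<bar>\<alpha> - lam\<bar> \<le> 6 * \<bar>\<alpha> - lam\<bar>"
      by (rule mult_right_mono) simp
    then have "(real_of_int (k + l) - real_of_int (i + j)) * (\<alpha> - lam) \<le> 6 * \<bar>\<alpha> - lam\<bar>"
      by (metis abs_le_D1 abs_mult)
    then show "- 6 * \<bar>\<alpha> - lam\<bar> + real_of_int (k + l) * (\<alpha> - lam) \<le> real_of_int (i + j) * (\<alpha> - lam)"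
      by (simp add: algebra_simps)
  qed simp
  moreover have "(1 / 64) powr (1 / p) * measure lebesgue ?R powr (1 / p) \<le> ?e i j powr (1 / p)"
    unfolding powr_mult[symmetric] using e p by (intro powr_mono2) auto
  ultimately have "?B \<le> 2 powr (real_of_int (i + j) * (\<alpha> - lam)) * ?e i j powr (1 / p)"
    using mult_mono[of "2 powr (- 6 * \<bar>\<alpha> - lam\<bar>) * 2 powr (real_of_int (k + l) * (\<alpha> - lam))"
      "2 powr (real_of_int (i + j) * (\<alpha> - lam))" "(1 / 64) powr (1 / p) * measure lebesgue ?R powr (1 / p)"
      "?e i j powr (1 / p)"]
    by (simp add: mult.assoc mult.left_commute[of "_ powr (1 / p)"])
  also have "\<dots> = 2 powr (- (real_of_int (i + j) * lam)) * (2 powr (real_of_int (i + j) * q * \<alpha>) * ?e i j powr (q / p)) powr (1 / q)"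
  proof -
    have "(2 powr (real_of_int (i + j) * q * \<alpha>) * ?e i j powr (q / p)) powr (1 / q)
        = 2 powr (real_of_int (i + j) * \<alpha>) * ?e i j powr (1 / p)"
      using q by (subst powr_mult) (simp_all add: powr_powr)
    moreover have "2 powr (real_of_int (i + j) * (\<alpha> - lam))
        = 2 powr (- (real_of_int (i + j) * lam)) * 2 powr (real_of_int (i + j) * \<alpha>)"
      unfolding powr_add[symmetric] by (rule arg_cong[of _ _ "(powr) 2"]) (simp add: algebra_simps)
    ultimately show ?thesis by (simp only: mult.assoc)
  qed
  finally have "ennreal ?B \<le> ennreal (2 powr (- (real_of_int (i + j) * lam)))
      * epowr (ennreal (2 powr (real_of_int (i + j) * q * \<alpha>) * ?e i j powr (q / p))) (1 / q)"
    by (subst epowr_ennreal) (auto simp: ennreal_leI simp flip: ennreal_mult')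
  also have "\<dots> \<le> ennreal (2 powr (- (real_of_int (i + j) * lam)))
      * epowr (\<Sum>\<^sub>\<infinity>(i, j)\<in>UNIV. ennreal (2 powr (real_of_int (i + j) * q * \<alpha>) * ?e i j powr (q / p))) (1 / q)"
    using q by (intro mult_left_mono epowr_mono)
       (auto simp: nonneg_infsum_complete intro!: SUP_upper2[of "{(i, j)}"])
  also have "\<dots> = ennreal (2 powr (- (real_of_int (i + j) * lam)))
      * herz_norm \<alpha> p q (restr (indicat_real ?R) (dyadic_cube i \<times> dyadic_cube j))"
    unfolding restr_indicator
    by (subst herz_norm_indicator)
       (auto intro!: fmeasurable_Int_fmeasurable rectangle_lmeasurable Times_sets_lebesgue sets_dyadic)
  also have "\<dots> \<le> morrey_herz_norm \<alpha> lam p q (indicat_real ?R)"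
    unfolding morrey_herz_norm_def by (rule SUP_upper2[of "(i, j)"]) auto
  finally show ?thesis .
qed

section \<open>Choice of the interpolation exponent and comparison of the two bounds\<close>

theorem theorem5p3:
  fixes \<alpha> lam p q :: real
    and f :: "(real^'n) \<times> (real^'m) \<Rightarrow> 'b::{real_normed_field, euclidean_space}"
  assumes "1 < p" and "1 < q"
    and "0 < lam" and "lam < min (\<alpha> + real CARD('n) / p) (\<alpha> + real CARD('m) / p)"
    and "max (- (real CARD('n) / p)) (- (real CARD('m) / p)) < \<alpha>"
    and "\<alpha> < min (real CARD('n) * (1 - 1 / p)) (real CARD('m) * (1 - 1 / p))"
    and "f \<in> bmo - ae_constant"
  shows "\<exists>C\<^sub>1 C\<^sub>2 :: real. 0 < C\<^sub>1 \<and> 0 < C\<^sub>2 \<and>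
    (\<forall>\<gamma>>0. \<forall>R\<in>rectangles.
      morrey_herz_norm \<alpha> lam p q (indicat_real {z \<in> R. \<gamma> < norm (f z - average f R)})
        \<le> ennreal (C\<^sub>1 * exp (- (C\<^sub>2 * \<gamma> / enn2real (bmo_norm f))))
          * morrey_herz_norm \<alpha> lam p q (indicat_real R))"
proof -
  let ?n = "real CARD('n)" and ?m = "real CARD('m)"
  have p: "0 < p" and q: "0 < q" and f: "f \<in> bmo" using assms by auto
  \<comment> \<open>The slack in the hypothesis on \<open>lam\<close>. Then \<open>\<theta>\<close>
    is taken so small that the interpolation losses \<open>\<theta> * ?n / p\<close> and
    \<open>\<theta> * ?m / p\<close> stay below it, which keeps both geometric ratios below
    1.\<close>
  define d where "d = min (\<alpha> + ?n / p) (\<alpha> + ?m / p) - lam"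
  have d: "0 < d" using assms by (simp add: d_def)
  define \<theta> where "\<theta> = min (1 / 2) (d * p / (2 * (?n + ?m)))"
  have nm: "0 < ?n + ?m" by (simp add: add_pos_pos)
  have \<theta>: "0 < \<theta>" "\<theta> \<le> 1" using d p nm by (auto simp: \<theta>_def)
  define t where "t = (1 - \<theta>) / p"
  have "\<theta> * (?n + ?m) / p \<le> d / 2"
  proof -
    have "\<theta> * (?n + ?m) \<le> d * p / (2 * (?n + ?m)) * (?n + ?m)"
      using nm by (intro mult_right_mono) (auto simp: \<theta>_def)
    also have "X / (2 * N) * N = X / 2" if "0 < N" for X N :: real using that by simp
    from this[OF nm] have "d * p / (2 * (?n + ?m)) * (?n + ?m) = d * p / 2" .
    finally show ?thesis using p by (simp add: pos_divide_le_eq)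
  qed
  then have "\<theta> * ?n / p + \<theta> * ?m / p \<le> d / 2" by (simp add: distrib_left add_divide_distrib)
  moreover have "0 \<le> \<theta> * ?n / p" "0 \<le> \<theta> * ?m / p" using \<theta> p by auto
  ultimately have "\<theta> * ?n / p < d" "\<theta> * ?m / p < d" using d by linarith+
  then have "0 < \<alpha> - lam + (?n / p - \<theta> * ?n / p)" "0 < \<alpha> - lam + (?m / p - \<theta> * ?m / p)"
    unfolding d_def by linarith+
  moreover have "?n * t = ?n / p - \<theta> * ?n / p" "?m * t = ?m / p - \<theta> * ?m / p"
    by (simp_all add: t_def diff_divide_distrib algebra_simps)
  ultimately have s: "0 < q * (\<alpha> - lam + ?n * t)" "0 < q * (\<alpha> - lam + ?m * t)"
    using q by simp_all
  define K where "K = (8 ^ CARD('n) * 8 ^ CARD('m)) powr t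
    * (1 / (1 - 2 powr (- (q * (\<alpha> - lam + ?n * t)))) * (1 / (1 - 2 powr (- (q * (\<alpha> - lam + ?m * t)))))) powr (1 / q)"
  have "2 powr (- (q * (\<alpha> - lam + ?n * t))) < 1" "2 powr (- (q * (\<alpha> - lam + ?m * t))) < 1"
    using s powr_less_mono[of "- (q * (\<alpha> - lam + ?n * t))" 0 2]
      powr_less_mono[of "- (q * (\<alpha> - lam + ?m * t))" 0 2] by auto
  then have K: "0 < K" by (auto simp: K_def zero_less_mult_iff)
  define c where "c = 2 powr (- 6 * \<bar>\<alpha> - lam\<bar>) * (1 / 64) powr (1 / p)"
  have c: "0 < c" by (simp add: c_def)
  define M where "M = enn2real (bmo_norm f)"
  define D :: real where "D = 2 + 2 ^ (CARD('n) + CARD('m))"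
  have D: "0 < D" by (simp add: D_def add_pos_pos)
  \<comment> \<open>\<open>K\<close> and \<open>c\<close> are the constants of the upper and lower
    bounds. The John--Nirenberg factor enters to the power \<open>\<theta> / p\<close>, which turns
    6 into \<open>6 powr (\<theta> / p)\<close> and multiplies the decay rate by
    \<open>\<theta> / p\<close> in \<open>C2\<close>.\<close>
  define C1 where "C1 = K * 6 powr (\<theta> / p) / c"
  define C2 where "C2 = ln (3 / 2) * \<theta> / (2 * p * D)"
  show ?thesis
  proof (intro exI conjI allI impI ballI)
    show "0 < C1" using K c by (simp add: C1_def)
    show "0 < C2" using \<theta> p D by (simp add: C2_def)
    fix \<gamma> :: real and R :: "((real^'n) \<times> (real^'m)) set"
    assume \<gamma>: "0 < \<gamma>" and R: "R \<in> rectangles"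
    obtain x :: "real^'n" and y :: "real^'m" and r s where
      R_eq: "R = cube x r \<times> cube y s" and r: "0 < r" and s': "0 < s"
      using R by (auto simp: rectangles_def)
    obtain k where k: "cube x r \<subseteq> dyadic_cube k" "\<And>i. measure lebesgue (cube x r \<inter> dyadic_cube i)
        \<le> 8 ^ CARD('n) * 2 powr (?n * (real_of_int i - real_of_int k)) * measure lebesgue (cube x r)"
      using cube_dyadic_scale[OF r] by blast
    obtain l where l: "cube y s \<subseteq> dyadic_cube l" "\<And>i. measure lebesgue (cube y s \<inter> dyadic_cube i)
        \<le> 8 ^ CARD('m) * 2 powr (?m * (real_of_int i - real_of_int l)) * measure lebesgue (cube y s)"
      using cube_dyadic_scale[OF s'] by blast
    define E where "E = {z \<in> R. \<gamma> < norm (f z - average f R)}"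
    define \<epsilon> where "\<epsilon> = 6 * exp (- (ln (3 / 2) / (D * M) * \<gamma> / 2))"
    \<comment> \<open>The common size of both bounds, the only part that depends on the
      rectangle.\<close>
    define Y where "Y = 2 powr (real_of_int (k + l) * (\<alpha> - lam)) * measure lebesgue R powr (1 / p)"
    have f_int: "set_integrable lebesgue R f"
      using f unfolding bmo_def locally_integrable_def R_eq rectangle_eq_cbox by auto
    have E: "E \<in> lmeasurable" "E \<subseteq> cube x r \<times> cube y s"
      unfolding E_def using superlevel_set_lmeasurable[OF _ f_int]
      by (auto simp: R_eq rectangle_lmeasurable)
    have E_le: "measure lebesgue E \<le> \<epsilon> * measure lebesgue (cube x r \<times> cube y s)"
      using bmo_john_nirenberg[OF f R \<gamma>] by (simp add: E_def \<epsilon>_def D_def M_def flip: R_eq)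
    have "\<epsilon> powr (\<theta> / p) = 6 powr (\<theta> / p) * exp (- (C2 * \<gamma> / M))"
      unfolding \<epsilon>_def C2_def by (subst powr_mult) (simp_all add: exp_powr_real field_simps)
    then have eq: "K * \<epsilon> powr (\<theta> / p) * Y = C1 * exp (- (C2 * \<gamma> / M)) * (c * Y)"
      using c by (simp add: C1_def)
    have "morrey_herz_norm \<alpha> lam p q (indicat_real E) \<le> ennreal (K * \<epsilon> powr (\<theta> / p) * Y)"
      unfolding K_def Y_def t_def R_eq
      by (rule morrey_herz_indicator_le[OF p q _ _ _ _ _ r s' E E_le _ k l])
         (use assms \<theta> s in \<open>auto simp: \<epsilon>_def t_def\<close>)
    also have "\<dots> = ennreal (C1 * exp (- (C2 * \<gamma> / M))) * ennreal (c * Y)"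
      unfolding eq using K c by (intro ennreal_mult) (auto simp: C1_def Y_def)
    also have "\<dots> \<le> ennreal (C1 * exp (- (C2 * \<gamma> / M))) * morrey_herz_norm \<alpha> lam p q (indicat_real R)"
      using morrey_herz_rectangle_ge[OF p q r s' k l, of \<alpha> lam]
      by (intro mult_left_mono) (auto simp: c_def Y_def R_eq)
    finally show "morrey_herz_norm \<alpha> lam p q (indicat_real {z \<in> R. \<gamma> < norm (f z - average f R)})
        \<le> ennreal (C1 * exp (- (C2 * \<gamma> / enn2real (bmo_norm f)))) * morrey_herz_norm \<alpha> lam p q (indicat_real R)"
      by (simp add: E_def M_def)
  qed
qed

end
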